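(* Let $(\mathbb X,\otimes,R,\sigma)$ be a differential linear category with monoidal coalgebra modality $(!,\rho,\varepsilon,\Delta,\mathsf e,\mathsf m,\mathsf m_R)$ and deriving transformation $\mathsf d$. Then $\mathbb X$ has antiderivatives (i.e. $\mathsf K$ is a natural isomorphism) if and only if there is a map $\mathsf s_R:{!R}\to{!R}$ such that $$\mathsf s_R\,\mathsf d_R+{!(0)}=1_{!R},$$ where $R$ is the monoidal unit, $\mathsf d_R:{!R}={!R}\otimes R\to{!R}$ is the component of $\mathsf d$ at $R$, and $!(0):{!R}\to{!R}$ is the image under $!$ of the zero map $0:R\to R$.
   Context: Conventions. Composition is written in diagrammatic order: $fg$ means first $f$, then $g$. Symmetric monoidal categories $(\mathbb X,\otimes,R,\sigma)$ are taken to be strict, with unit $R$ and symmetry $\sigma$, so $A\otimes R=A=R\otimes A$ and in particular $!R\otimes R={!R}$. Additive symmetric monoidal category: a symmetric monoidal category whose hom-sets are commutative monoids $(+,0)$ (no negatives or biproducts assumed), with $k(f+g)h=kfh+kgh$, $k0h=0$, $k\otimes(f+g)\otimes h=k\otimes f\otimes h+k\otimes g\otimes h$, $k\otimes 0\otimes h=0$. Coalgebra modality $(!,\rho,\varepsilon,\Delta,\mathsf e)$: a functor $!:\mathbb X\to\mathbb X$ with natural transformations $\rho_A:{!A}\to{!!A}$, $\varepsilon_A:{!A}\to A$, $\Delta_A:{!A}\to{!A}\otimes{!A}$, $\mathsf e_A:{!A}\to R$ such that $(!,\rho,\varepsilon)$ is a comonad, each $({!A},\Delta_A,\mathsf e_A)$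 is a cocommutative comonoid, and $\rho_A$ is a comonoid morphism ($\Delta_A(\rho_A\otimes\rho_A)=\rho_A\Delta_{!A}$, $\rho_A\mathsf e_{!A}=\mathsf e_A$). Monoidal coalgebra modality: a coalgebra modality with a natural transformation $\mathsf m_{A,B}:{!A}\otimes{!B}\to{!(A\otimes B)}$ and a map $\mathsf m_R:R\to{!R}$ such that: (i) $(!,\mathsf m,\mathsf m_R)$ is a (lax) symmetric monoidal functor; (ii) $\rho$ and $\varepsilon$ are monoidal: $\mathsf m_{A,B}\rho_{A\otimes B}=(\rho_A\otimes\rho_B)\mathsf m_{!A,!B}{!(\mathsf m_{A,B})}$, $\mathsf m_{A,B}\varepsilon_{A\otimes B}=\varepsilon_A\otimes\varepsilon_B$, $\mathsf m_R\rho_R=\mathsf m_R{!(\mathsf m_R)}$, $\mathsf m_R\varepsilon_R=1_R$; (iii) $\Delta$ and $\mathsf e$ are monoidal: $\mathsf m_{A,B}\Delta_{A\otimes B}=(\Delta_A\otimes\Delta_B)(1\otimes\sigma_{!A,!B}\otimes1)(\mathsf m_{A,B}\otimes\mathsf m_{A,B})$, $\mathsf m_{A,B}\mathsf e_{A\otimes B}=\mathsf e_A\otimes\mathsf e_B$, $\mathsf m_R\Delta_R=\mathsf m_R\otimes\mathsf m_R$, $\mathsf m_R\mathsf e_R=1_R$; (iv) $\Delta$ and $\mathsf e$ are $!$-coalgebra morphisms: $\rho_A{!(\Delta_A)}=\Delta_A(\rho_A\otimes\rho_A)\mathsf m_{!A,!A}$, $\rho_A{!(\mathsf e_A)}=\mathsf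 e_A\mathsf m_R$. Differential category: an additive symmetric monoidal category with a coalgebra modality and a deriving transformation, i.e. a natural transformation $\mathsf d_A:{!A}\otimes A\to{!A}$ with: $\mathsf d_A\mathsf e_A=0$; $\mathsf d_A\Delta_A=(\Delta_A\otimes1_A)(1_{!A}\otimes\sigma_{!A,A})(\mathsf d_A\otimes1_{!A})+(\Delta_A\otimes1_A)(1_{!A}\otimes\mathsf d_A)$; $\mathsf d_A\varepsilon_A=\mathsf e_A\otimes1_A$; $\mathsf d_A\rho_A=(\Delta_A\otimes1_A)(\rho_A\otimes\mathsf d_A)\mathsf d_{!A}$; $(\mathsf d_A\otimes1_A)\mathsf d_A=(1_{!A}\otimes\sigma_{A,A})(\mathsf d_A\otimes1_A)\mathsf d_A$. Differential linear category: a differential category whose coalgebra modality is a monoidal coalgebra modality. Coderiving transformation: $\mathsf d^\circ_A:=\Delta_A(1_{!A}\otimes\varepsilon_A):{!A}\to{!A}\otimes A$. Define $\mathsf K_A:=\mathsf d^\circ_A\mathsf d_A+{!(0)}:{!A}\to{!A}$ (with $0:A\to A$). A differential category has antiderivatives if $\mathsf K$ is a natural isomorphism. *)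

theory Defs
  imports Main
begin

section \<open>Categories\<close>

text \<open>
  Objects and arrows form carrier sets inside two arbitrary types; every operation is
  only constrained on arguments for which it is meaningful.  Composition is written in
  diagrammatic order throughout: \<open>f \<cdot> g\<close> is first \<open>f\<close>, then \<open>g\<close>.  Among the infix
  operations, tensors bind strongest, then composition, then sums of arrows.
\<close>

record ('o, 'a) cat =
  Obj :: "'o set"
  Arr :: "'a set"
  Dom :: "'a \<Rightarrow> 'o"
  Cod :: "'a \<Rightarrow> 'o"
  ident :: "'o \<Rightarrow> 'a"  (\<open>\<one>\<index>\<close>)
  comp :: "'a \<Rightarrow> 'a \<Rightarrow> 'a"  (infixl \<open>\<cdot>\<index>\<close> 70)

definition Hom :: "('o, 'a, 'z) cat_scheme \<Rightarrow> 'o \<Rightarrow> 'o \<Rightarrow> 'a set" where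
  "Hom X A B = {f \<in> Arr X. Dom X f = A \<and> Cod X f = B}"

locale category =
  fixes X :: "('o, 'a, 'z) cat_scheme" (structure)
  assumes Dom_Obj: "f \<in> Arr X \<Longrightarrow> Dom X f \<in> Obj X"
    and Cod_Obj: "f \<in> Arr X \<Longrightarrow> Cod X f \<in> Obj X"
    and ident_Hom: "A \<in> Obj X \<Longrightarrow> \<one> A \<in> Hom X A A"
    and comp_Hom: "f \<in> Hom X A B \<Longrightarrow> g \<in> Hom X B C \<Longrightarrow> f \<cdot> g \<in> Hom X A C"
    and ident_comp: "f \<in> Hom X A B \<Longrightarrow> \<one> A \<cdot> f = f"
    and comp_ident: "f \<in> Hom X A B \<Longrightarrow> f \<cdot> \<one> B = f"
    and comp_assoc: "f \<in> Hom X A B \<Longrightarrow> g \<in> Hom X B C \<Longrightarrow> h \<in> Hom X C D \<Longrightarrow>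
      (f \<cdot> g) \<cdot> h = f \<cdot> (g \<cdot> h)"

definition is_iso :: "('o, 'a, 'z) cat_scheme \<Rightarrow> 'a \<Rightarrow> bool" where
  "is_iso X f \<longleftrightarrow> f \<in> Arr X \<and>
     (\<exists>g \<in> Hom X (Cod X f) (Dom X f).
        f \<cdot>\<^bsub>X\<^esub> g = \<one>\<^bsub>X\<^esub> (Dom X f) \<and> g \<cdot>\<^bsub>X\<^esub> f = \<one>\<^bsub>X\<^esub> (Cod X f))"

locale endofunctor = category X
  for X :: "('o, 'a, 'z) cat_scheme" (structure) +
  fixes F :: "'o \<Rightarrow> 'o" and F' :: "'a \<Rightarrow> 'a"
  assumes map_Obj: "A \<in> Obj X \<Longrightarrow> F A \<in> Obj X"
    and map_Hom: "f \<in> Hom X A B \<Longrightarrow> F' f \<in> Hom X (F A) (F B)"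
    and map_ident: "A \<in> Obj X \<Longrightarrow> F' (\<one> A) = \<one> (F A)"
    and map_comp: "f \<in> Hom X A B \<Longrightarrow> g \<in> Hom X B C \<Longrightarrow> F' (f \<cdot> g) = F' f \<cdot> F' g"

text \<open>
  Naturality of a family \<open>t\<close> of arrows between two endofunctors, each given by its object
  map and its arrow map (functoriality of the two sides is not part of the predicate).
\<close>

definition natural_transformation ::
  "('o, 'a, 'z) cat_scheme \<Rightarrow> ('o \<Rightarrow> 'o) \<Rightarrow> ('a \<Rightarrow> 'a) \<Rightarrow> ('o \<Rightarrow> 'o) \<Rightarrow> ('a \<Rightarrow> 'a) \<Rightarrow> ('o \<Rightarrow> 'a) \<Rightarrow> bool"
where
  "natural_transformation X F F' G G' t \<longleftrightarrow>
     (\<forall>A \<in> Obj X. t A \<in> Hom X (F A) (G A)) \<and>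
     (\<forall>A B. \<forall>f \<in> Hom X A B. F' f \<cdot>\<^bsub>X\<^esub> t B = t A \<cdot>\<^bsub>X\<^esub> G' f)"

definition natural_isomorphism ::
  "('o, 'a, 'z) cat_scheme \<Rightarrow> ('o \<Rightarrow> 'o) \<Rightarrow> ('a \<Rightarrow> 'a) \<Rightarrow> ('o \<Rightarrow> 'o) \<Rightarrow> ('a \<Rightarrow> 'a) \<Rightarrow> ('o \<Rightarrow> 'a) \<Rightarrow> bool"
where
  "natural_isomorphism X F F' G G' t \<longleftrightarrow>
     natural_transformation X F F' G G' t \<and> (\<forall>A \<in> Obj X. is_iso X (t A))"

locale comonad = endofunctor X F F'
  for X :: "('o, 'a, 'z) cat_scheme" (structure) and F F' +
  fixes \<rho> :: "'o \<Rightarrow> 'a" and \<epsilon> :: "'o \<Rightarrow> 'a"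
  assumes rho_natural:
      "natural_transformation X F F' (\<lambda>A. F (F A)) (\<lambda>f. F' (F' f)) \<rho>"
    and eps_natural: "natural_transformation X F F' (\<lambda>A. A) (\<lambda>f. f) \<epsilon>"
    and rho_coassoc: "A \<in> Obj X \<Longrightarrow> \<rho> A \<cdot> \<rho> (F A) = \<rho> A \<cdot> F' (\<rho> A)"
    and rho_eps: "A \<in> Obj X \<Longrightarrow> \<rho> A \<cdot> \<epsilon> (F A) = \<one> (F A)"
    and rho_map_eps: "A \<in> Obj X \<Longrightarrow> \<rho> A \<cdot> F' (\<epsilon> A) = \<one> (F A)"


section \<open>Strict symmetric monoidal and additive categories\<close>

record ('o, 'a) smc = "('o, 'a) cat" +
  tensor_obj :: "'o \<Rightarrow> 'o \<Rightarrow> 'o"  (infixl \<open>\<odot>\<index>\<close> 75)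
  tensor :: "'a \<Rightarrow> 'a \<Rightarrow> 'a"  (infixl \<open>\<otimes>\<index>\<close> 75)
  unit_obj :: 'o  (\<open>I\<index>\<close>)
  sym_arr :: "'o \<Rightarrow> 'o \<Rightarrow> 'a"  (\<open>\<sigma>\<index>\<close>)

text \<open>
  \<open>A \<odot> B\<close> is the tensor of objects, \<open>f \<otimes> g\<close> the tensor of arrows, \<open>I\<close> the monoidal unit.
  The monoidal structure is strict: associators and unitors are identities, so they are
  equations between objects and between arrows.
\<close>

locale symmetric_monoidal_category = category X
  for X :: "('o, 'a, 'z) smc_scheme" (structure) +
  assumes unit_Obj: "I \<in> Obj X"
    and tensor_Obj: "A \<in> Obj X \<Longrightarrow> B \<in> Obj X \<Longrightarrow> A \<odot> B \<in> Obj X"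
    and tensor_Hom: "f \<in> Hom X A B \<Longrightarrow> g \<in> Hom X C D \<Longrightarrow> f \<otimes> g \<in> Hom X (A \<odot> C) (B \<odot> D)"
    and tensor_ident: "A \<in> Obj X \<Longrightarrow> B \<in> Obj X \<Longrightarrow> \<one> A \<otimes> \<one> B = \<one> (A \<odot> B)"
    and tensor_comp: "f \<in> Hom X A B \<Longrightarrow> f' \<in> Hom X B C \<Longrightarrow> g \<in> Hom X D E \<Longrightarrow> g' \<in> Hom X E F \<Longrightarrow>
      (f \<cdot> f') \<otimes> (g \<cdot> g') = (f \<otimes> g) \<cdot> (f' \<otimes> g')"
    and tensor_obj_assoc: "A \<in> Obj X \<Longrightarrow> B \<in> Obj X \<Longrightarrow> C \<in> Obj X \<Longrightarrow> (A \<odot> B) \<odot> C = A \<odot> (B \<odot> C)"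
    and tensor_assoc: "f \<in> Arr X \<Longrightarrow> g \<in> Arr X \<Longrightarrow> h \<in> Arr X \<Longrightarrow> (f \<otimes> g) \<otimes> h = f \<otimes> (g \<otimes> h)"
    and obj_unit_left: "A \<in> Obj X \<Longrightarrow> I \<odot> A = A"
    and obj_unit_right: "A \<in> Obj X \<Longrightarrow> A \<odot> I = A"
    and arr_unit_left: "f \<in> Arr X \<Longrightarrow> \<one> I \<otimes> f = f"
    and arr_unit_right: "f \<in> Arr X \<Longrightarrow> f \<otimes> \<one> I = f"
    and sym_Hom: "A \<in> Obj X \<Longrightarrow> B \<in> Obj X \<Longrightarrow> \<sigma> A B \<in> Hom X (A \<odot> B) (B \<odot> A)"
    and sym_natural: "f \<in> Hom X A B \<Longrightarrow> g \<in> Hom X C D \<Longrightarrow> (f \<otimes> g) \<cdot> \<sigma> B D = \<sigma> A C \<cdot> (g \<otimes> f)"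
    and sym_inverse: "A \<in> Obj X \<Longrightarrow> B \<in> Obj X \<Longrightarrow> \<sigma> A B \<cdot> \<sigma> B A = \<one> (A \<odot> B)"
    and sym_unit: "A \<in> Obj X \<Longrightarrow> \<sigma> A I = \<one> A"
    and sym_hexagon: "A \<in> Obj X \<Longrightarrow> B \<in> Obj X \<Longrightarrow> C \<in> Obj X \<Longrightarrow>
      \<sigma> A (B \<odot> C) = (\<sigma> A B \<otimes> \<one> C) \<cdot> (\<one> B \<otimes> \<sigma> A C)"

record ('o, 'a) asmc = "('o, 'a) smc" +
  plus_arr :: "'a \<Rightarrow> 'a \<Rightarrow> 'a"  (infixl \<open>\<oplus>\<index>\<close> 65)
  zero_arr :: "'o \<Rightarrow> 'o \<Rightarrow> 'a"  (\<open>\<zero>\<index>\<close>)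

locale additive_symmetric_monoidal_category = symmetric_monoidal_category X
  for X :: "('o, 'a, 'z) asmc_scheme" (structure) +
  assumes plus_Hom: "f \<in> Hom X A B \<Longrightarrow> g \<in> Hom X A B \<Longrightarrow> f \<oplus> g \<in> Hom X A B"
    and zero_Hom: "A \<in> Obj X \<Longrightarrow> B \<in> Obj X \<Longrightarrow> \<zero> A B \<in> Hom X A B"
    and plus_assoc: "f \<in> Hom X A B \<Longrightarrow> g \<in> Hom X A B \<Longrightarrow> h \<in> Hom X A B \<Longrightarrow>
      (f \<oplus> g) \<oplus> h = f \<oplus> (g \<oplus> h)"
    and plus_commute: "f \<in> Hom X A B \<Longrightarrow> g \<in> Hom X A B \<Longrightarrow> f \<oplus> g = g \<oplus> f"
    and zero_plus: "f \<in> Hom X A B \<Longrightarrow> \<zero> A B \<oplus> f = f"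
    and comp_plus: "k \<in> Hom X A B \<Longrightarrow> f \<in> Hom X B C \<Longrightarrow> g \<in> Hom X B C \<Longrightarrow> h \<in> Hom X C D \<Longrightarrow>
      k \<cdot> (f \<oplus> g) \<cdot> h = k \<cdot> f \<cdot> h \<oplus> k \<cdot> g \<cdot> h"
    and comp_zero: "k \<in> Hom X A B \<Longrightarrow> h \<in> Hom X C D \<Longrightarrow> k \<cdot> \<zero> B C \<cdot> h = \<zero> A D"
    and tensor_plus: "k \<in> Hom X A B \<Longrightarrow> f \<in> Hom X C D \<Longrightarrow> g \<in> Hom X C D \<Longrightarrow> h \<in> Hom X E F \<Longrightarrow>
      k \<otimes> (f \<oplus> g) \<otimes> h = k \<otimes> f \<otimes> h \<oplus> k \<otimes> g \<otimes> h"
    and tensor_zero: "k \<in> Hom X A B \<Longrightarrow> C \<in> Obj X \<Longrightarrow> D \<in> Obj X \<Longrightarrow> h \<in> Hom X E F \<Longrightarrow>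
      k \<otimes> \<zero> C D \<otimes> h = \<zero> (A \<odot> C \<odot> E) (B \<odot> D \<odot> F)"

definition cocommutative_comonoid :: "('o, 'a, 'z) smc_scheme \<Rightarrow> 'o \<Rightarrow> 'a \<Rightarrow> 'a \<Rightarrow> bool" where
  "cocommutative_comonoid X C \<delta> u \<longleftrightarrow>
     C \<in> Obj X \<and> \<delta> \<in> Hom X C (C \<odot>\<^bsub>X\<^esub> C) \<and> u \<in> Hom X C I\<^bsub>X\<^esub> \<and>
     \<delta> \<cdot>\<^bsub>X\<^esub> (\<delta> \<otimes>\<^bsub>X\<^esub> \<one>\<^bsub>X\<^esub> C) = \<delta> \<cdot>\<^bsub>X\<^esub> (\<one>\<^bsub>X\<^esub> C \<otimes>\<^bsub>X\<^esub> \<delta>) \<and>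
     \<delta> \<cdot>\<^bsub>X\<^esub> (u \<otimes>\<^bsub>X\<^esub> \<one>\<^bsub>X\<^esub> C) = \<one>\<^bsub>X\<^esub> C \<and>
     \<delta> \<cdot>\<^bsub>X\<^esub> (\<one>\<^bsub>X\<^esub> C \<otimes>\<^bsub>X\<^esub> u) = \<one>\<^bsub>X\<^esub> C \<and>
     \<delta> \<cdot>\<^bsub>X\<^esub> \<sigma>\<^bsub>X\<^esub> C C = \<delta>"

locale symmetric_monoidal_endofunctor =
  symmetric_monoidal_category X + endofunctor X F F'
  for X :: "('o, 'a, 'z) smc_scheme" (structure) and F F' +
  fixes m :: "'o \<Rightarrow> 'o \<Rightarrow> 'a" and m\<^sub>I :: 'a
  assumes m_Hom: "A \<in> Obj X \<Longrightarrow> B \<in> Obj X \<Longrightarrow> m A B \<in> Hom X (F A \<odot> F B) (F (A \<odot> B))"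
    and m_natural: "f \<in> Hom X A B \<Longrightarrow> g \<in> Hom X C D \<Longrightarrow>
      (F' f \<otimes> F' g) \<cdot> m B D = m A C \<cdot> F' (f \<otimes> g)"
    and mI_Hom: "m\<^sub>I \<in> Hom X I (F I)"
    and m_assoc: "A \<in> Obj X \<Longrightarrow> B \<in> Obj X \<Longrightarrow> C \<in> Obj X \<Longrightarrow>
      (m A B \<otimes> \<one> (F C)) \<cdot> m (A \<odot> B) C = (\<one> (F A) \<otimes> m B C) \<cdot> m A (B \<odot> C)"
    and m_unit_left: "A \<in> Obj X \<Longrightarrow> (m\<^sub>I \<otimes> \<one> (F A)) \<cdot> m I A = \<one> (F A)"
    and m_unit_right: "A \<in> Obj X \<Longrightarrow> (\<one> (F A) \<otimes> m\<^sub>I) \<cdot> m A I = \<one> (F A)"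
    and m_sym: "A \<in> Obj X \<Longrightarrow> B \<in> Obj X \<Longrightarrow> \<sigma> (F A) (F B) \<cdot> m B A = m A B \<cdot> F' (\<sigma> A B)"


section \<open>Coalgebra modalities\<close>

text \<open>The functor \<open>!\<close> has object map \<open>Bang\<close> and arrow map \<open>bang\<close>.\<close>

locale coalgebra_modality =
  symmetric_monoidal_category X + comonad X Bang bang \<rho> \<epsilon>
  for X :: "('o, 'a, 'z) smc_scheme" (structure) and Bang bang \<rho> \<epsilon> +
  fixes \<Delta> :: "'o \<Rightarrow> 'a" and e :: "'o \<Rightarrow> 'a"
  assumes Delta_natural:
      "natural_transformation X Bang bang (\<lambda>A. Bang A \<odot> Bang A) (\<lambda>f. bang f \<otimes> bang f) \<Delta>"
    and e_natural: "natural_transformation X Bang bang (\<lambda>_. I) (\<lambda>_. \<one> I) e"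
    and comonoid: "A \<in> Obj X \<Longrightarrow> cocommutative_comonoid X (Bang A) (\<Delta> A) (e A)"
    and rho_Delta: "A \<in> Obj X \<Longrightarrow> \<Delta> A \<cdot> (\<rho> A \<otimes> \<rho> A) = \<rho> A \<cdot> \<Delta> (Bang A)"
    and rho_e: "A \<in> Obj X \<Longrightarrow> \<rho> A \<cdot> e (Bang A) = e A"

locale monoidal_coalgebra_modality =
  coalgebra_modality X Bang bang \<rho> \<epsilon> \<Delta> e +
  symmetric_monoidal_endofunctor X Bang bang m m\<^sub>I
  for X :: "('o, 'a, 'z) smc_scheme" (structure) and Bang bang \<rho> \<epsilon> \<Delta> e m m\<^sub>I +
  assumes m_rho: "A \<in> Obj X \<Longrightarrow> B \<in> Obj X \<Longrightarrow>
      m A B \<cdot> \<rho> (A \<odot> B) = (\<rho> A \<otimes> \<rho> B) \<cdot> m (Bang A) (Bang B) \<cdot> bang (m A B)"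
    and m_eps: "A \<in> Obj X \<Longrightarrow> B \<in> Obj X \<Longrightarrow> m A B \<cdot> \<epsilon> (A \<odot> B) = \<epsilon> A \<otimes> \<epsilon> B"
    and mI_rho: "m\<^sub>I \<cdot> \<rho> I = m\<^sub>I \<cdot> bang m\<^sub>I"
    and mI_eps: "m\<^sub>I \<cdot> \<epsilon> I = \<one> I"
    and m_Delta: "A \<in> Obj X \<Longrightarrow> B \<in> Obj X \<Longrightarrow>
      m A B \<cdot> \<Delta> (A \<odot> B) =
        (\<Delta> A \<otimes> \<Delta> B) \<cdot> (\<one> (Bang A) \<otimes> \<sigma> (Bang A) (Bang B) \<otimes> \<one> (Bang B)) \<cdot> (m A B \<otimes> m A B)"
    and m_e: "A \<in> Obj X \<Longrightarrow> B \<in> Obj X \<Longrightarrow> m A B \<cdot> e (A \<odot> B) = e A \<otimes> e B"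
    and mI_Delta: "m\<^sub>I \<cdot> \<Delta> I = m\<^sub>I \<otimes> m\<^sub>I"
    and mI_e: "m\<^sub>I \<cdot> e I = \<one> I"
    and Delta_coalgebra: "A \<in> Obj X \<Longrightarrow>
      \<rho> A \<cdot> bang (\<Delta> A) = \<Delta> A \<cdot> (\<rho> A \<otimes> \<rho> A) \<cdot> m (Bang A) (Bang A)"
    and e_coalgebra: "A \<in> Obj X \<Longrightarrow> \<rho> A \<cdot> bang (e A) = e A \<cdot> m\<^sub>I"


section \<open>Differential categories and antiderivatives\<close>

locale differential_category =
  additive_symmetric_monoidal_category X + coalgebra_modality X Bang bang \<rho> \<epsilon> \<Delta> e
  for X :: "('o, 'a, 'z) asmc_scheme" (structure) and Bang bang \<rho> \<epsilon> \<Delta> e +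
  fixes d :: "'o \<Rightarrow> 'a"
  assumes d_natural:
      "natural_transformation X (\<lambda>A. Bang A \<odot> A) (\<lambda>f. bang f \<otimes> f) Bang bang d"
    and d_constant: "A \<in> Obj X \<Longrightarrow> d A \<cdot> e A = \<zero> (Bang A \<odot> A) I"
    and d_product: "A \<in> Obj X \<Longrightarrow>
      d A \<cdot> \<Delta> A =
        (\<Delta> A \<otimes> \<one> A) \<cdot> (\<one> (Bang A) \<otimes> \<sigma> (Bang A) A) \<cdot> (d A \<otimes> \<one> (Bang A))
        \<oplus> (\<Delta> A \<otimes> \<one> A) \<cdot> (\<one> (Bang A) \<otimes> d A)"
    and d_linear: "A \<in> Obj X \<Longrightarrow> d A \<cdot> \<epsilon> A = e A \<otimes> \<one> A"
    and d_chain: "A \<in> Obj X \<Longrightarrow> d A \<cdot> \<rho> A = (\<Delta> A \<otimes> \<one> A) \<cdot> (\<rho> A \<otimes> d A) \<cdot> d (Bang A)"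
    and d_interchange: "A \<in> Obj X \<Longrightarrow>
      (d A \<otimes> \<one> A) \<cdot> d A = (\<one> (Bang A) \<otimes> \<sigma> A A) \<cdot> (d A \<otimes> \<one> A) \<cdot> d A"

locale differential_linear_category =
  differential_category X Bang bang \<rho> \<epsilon> \<Delta> e d +
  monoidal_coalgebra_modality X Bang bang \<rho> \<epsilon> \<Delta> e m m\<^sub>I
  for X :: "('o, 'a, 'z) asmc_scheme" (structure) and Bang bang \<rho> \<epsilon> \<Delta> e m m\<^sub>I d

definition coderiving ::
  "('o, 'a, 'z) smc_scheme \<Rightarrow> ('o \<Rightarrow> 'o) \<Rightarrow> ('o \<Rightarrow> 'a) \<Rightarrow> ('o \<Rightarrow> 'a) \<Rightarrow> 'o \<Rightarrow> 'a"
where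
  "coderiving X Bang \<epsilon> \<Delta> A = \<Delta> A \<cdot>\<^bsub>X\<^esub> (\<one>\<^bsub>X\<^esub> (Bang A) \<otimes>\<^bsub>X\<^esub> \<epsilon> A)"

definition K_map ::
  "('o, 'a, 'z) asmc_scheme \<Rightarrow> ('o \<Rightarrow> 'o) \<Rightarrow> ('a \<Rightarrow> 'a) \<Rightarrow> ('o \<Rightarrow> 'a) \<Rightarrow> ('o \<Rightarrow> 'a) \<Rightarrow> ('o \<Rightarrow> 'a) \<Rightarrow>
    'o \<Rightarrow> 'a"
where
  "K_map X Bang bang \<epsilon> \<Delta> d A =
     coderiving X Bang \<epsilon> \<Delta> A \<cdot>\<^bsub>X\<^esub> d A \<oplus>\<^bsub>X\<^esub> bang (\<zero>\<^bsub>X\<^esub> A A)"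

definition has_antiderivatives ::
  "('o, 'a, 'z) asmc_scheme \<Rightarrow> ('o \<Rightarrow> 'o) \<Rightarrow> ('a \<Rightarrow> 'a) \<Rightarrow> ('o \<Rightarrow> 'a) \<Rightarrow> ('o \<Rightarrow> 'a) \<Rightarrow> ('o \<Rightarrow> 'a) \<Rightarrow> bool"
where
  "has_antiderivatives X Bang bang \<epsilon> \<Delta> d \<longleftrightarrow>
     natural_isomorphism X Bang bang Bang bang (K_map X Bang bang \<epsilon> \<Delta> d)"

end

theory Submission
  imports Defs
begin

text \<open>
  Points \<open>a : I \<rightarrow> !I\<close> act naturally on every \<open>!A\<close> by
  \<open>act A a = (1 \<otimes> a) m\<^bsub>A,I\<^esub> : !A \<rightarrow> !A\<close>.  Because \<open>m\<close> is associative, unital and symmetric, this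
  is an action of a commutative monoid: \<open>m\<^sub>I\<close> acts as the identity and the product of \<open>a\<close> and
  \<open>b\<close> is \<open>a \<cdot> act I b\<close> (\<open>act_comp\<close>, \<open>comp_act_commute\<close>).  The action is additive in \<open>a\<close>, it sends
  \<open>m\<^sub>I \<cdot> !(0)\<close> to \<open>!(0)\<close>, and it turns \<open>d\<^sub>I\<close> into the operator \<open>d\<degree>\<^sub>A ( _ \<otimes> 1) d\<^sub>A\<close> (\<open>act_d\<close>).
  Therefore \<open>K\<^sub>A\<close> is the action of the single point \<open>k = m\<^sub>I d\<^sub>I + m\<^sub>I !(0)\<close>, for every \<open>A\<close>, and
  \<open>K\<close> is a natural isomorphism as soon as \<open>k\<close> has an inverse in that monoid, that is, as soon as
  there is a point \<open>l\<close> with \<open>l K\<^sub>I = m\<^sub>I\<close>.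

  Such an \<open>l\<close> comes from \<open>s\<close>.  Think of \<open>!I\<close> as rational power series in \<open>x\<close>, with \<open>d\<^sub>I\<close> multiplication
  by \<open>x\<close>, \<open>d\<degree>\<^sub>I\<close> the derivative, \<open>m\<^sub>I\<close> the exponential series, \<open>!(0)\<close> the constant term and \<open>s\<close>
  division by \<open>x\<close> of the remaining terms.  The operator
  \<open>K\<^sub>I\<close> multiplies \<open>x\<^sup>n\<close> by \<open>n\<close> (and \<open>1\<close> by \<open>1\<close>).  The point \<open>t = m\<^sub>I s\<close> acts on \<open>x\<^sup>n\<close> as
  \<open>1 / (n + 1)\<close>, so it inverts \<open>J = d\<degree>\<^sub>I d\<^sub>I + 1 = d\<^sub>I d\<degree>\<^sub>I\<close>, and
  \<open>l = t \<cdot> act I t \<cdot> d\<^sub>I + m\<^sub>I !(0)\<close> is the series with coefficients \<open>1 / (n \<cdot> n!)\<close> and constant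
  term \<open>1\<close>.  The lemma \<open>point_inverting_K_unit\<close> carries this out with the equation for \<open>s\<close> only.
  Conversely, \<open>s = K\<^sub>I\<^sup>-\<^sup>1 d\<degree>\<^sub>I\<close> works because \<open>K\<^sub>I !(0) = !(0)\<close>.

  The substantial part is \<open>act_d\<close>, which needs to know how \<open>1 \<otimes> d\<^sub>B\<close> on \<open>!A \<otimes> !B\<close> interacts with
  \<open>m\<close>.  The map \<open>\<omega> = (\<rho>\<^sub>A \<otimes> \<rho>\<^sub>B) m\<close> makes \<open>!A \<otimes> !B\<close> a coalgebra, and \<open>m\<close> is \<open>\<omega>\<close> followed by
  \<open>!(\<epsilon>\<^sub>A \<otimes> \<epsilon>\<^sub>B)\<close>, so a chain rule for \<open>1 \<otimes> d\<^sub>B\<close> along \<open>\<omega>\<close> suffices (\<open>d_tensor_coalg\<close>).  If a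
  biproduct \<open>A \<oplus> B\<close> existed, then \<open>!A \<otimes> !B\<close> would be isomorphic to \<open>!(A \<oplus> B)\<close> and the chain rule there would
  give the claim.  In general a retract takes the place of this isomorphism: whenever \<open>W\<close> has
  injections and projections for \<open>A\<close> and \<open>B\<close>, \<open>!A \<otimes> !B\<close> is a retract of \<open>!W\<close> in a way that respects
  the coalgebra structure and the derivative, and \<open>W = !A \<otimes> !B\<close> itself has such maps, built from
  \<open>\<epsilon>\<close>, \<open>e\<close>, the codereliction and the point \<open>m\<^sub>I !(0)\<close>.
\<close>

section \<open>Typing of composites and tensors\<close>

lemma Hom_iff: "f \<in> Hom X A B \<longleftrightarrow> f \<in> Arr X \<and> Dom X f = A \<and> Cod X f = B"
  by (simp add: Hom_def)

context category
begin

lemma Dom_Cod_Obj [simp]: "f \<in> Arr X \<Longrightarrow> Dom X f \<in> Obj X" "f \<in> Arr X \<Longrightarrow> Cod X f \<in> Obj X"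
  by (simp_all add: Dom_Obj Cod_Obj)

lemma Hom_Obj: "f \<in> Hom X A B \<Longrightarrow> A \<in> Obj X" "f \<in> Hom X A B \<Longrightarrow> B \<in> Obj X"
  by (auto simp: Hom_iff)

lemma ident_typing [simp]:
  assumes "A \<in> Obj X"
  shows "\<one> A \<in> Arr X" "Dom X (\<one> A) = A" "Cod X (\<one> A) = A"
  using ident_Hom[OF assms] by (simp_all add: Hom_iff)

text \<open>
  Stating the types through \<open>Arr\<close>, \<open>Dom\<close> and \<open>Cod\<close> instead of \<open>Hom\<close> lets the simplifier
  discharge the typing conditions of all the conditional rewrite rules below.
\<close>

lemma comp_typing [simp]:
  assumes "f \<in> Arr X" "g \<in> Arr X" "Cod X f = Dom X g"
  shows "f \<cdot> g \<in> Arr X" "Dom X (f \<cdot> g) = Dom X f" "Cod X (f \<cdot> g) = Cod X g"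
  using comp_Hom[of f "Dom X f" "Cod X f" g "Cod X g"] assms by (simp_all add: Hom_iff)

lemma comp_assoc_right [simp]:
  "f \<in> Arr X \<Longrightarrow> g \<in> Arr X \<Longrightarrow> h \<in> Arr X \<Longrightarrow> Cod X f = Dom X g \<Longrightarrow> Cod X g = Dom X h \<Longrightarrow>
    (f \<cdot> g) \<cdot> h = f \<cdot> (g \<cdot> h)"
  by (rule comp_assoc) (simp_all add: Hom_iff)

lemma ident_cancel [simp]:
  "f \<in> Arr X \<Longrightarrow> Dom X f = A \<Longrightarrow> \<one> A \<cdot> f = f"
  "f \<in> Arr X \<Longrightarrow> Cod X f = A \<Longrightarrow> f \<cdot> \<one> A = f"
  by (auto intro: ident_comp comp_ident simp: Hom_iff)

text \<open>Extends a rewrite of a composite of two arrows to right-nested composites.\<close>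

lemma comp_eq_tail:
  assumes "f \<cdot> g = k" "f \<in> Arr X" "g \<in> Arr X" "h \<in> Arr X" "Cod X f = Dom X g" "Cod X g = Dom X h"
  shows "f \<cdot> (g \<cdot> h) = k \<cdot> h"
  using assms comp_assoc_right[of f g h] by simp

end

context symmetric_monoidal_category
begin

lemma object_simps [simp]:
  "I \<in> Obj X"
  "A \<in> Obj X \<Longrightarrow> B \<in> Obj X \<Longrightarrow> A \<odot> B \<in> Obj X"
  "A \<in> Obj X \<Longrightarrow> B \<in> Obj X \<Longrightarrow> C \<in> Obj X \<Longrightarrow> (A \<odot> B) \<odot> C = A \<odot> (B \<odot> C)"
  "A \<in> Obj X \<Longrightarrow> I \<odot> A = A"
  "A \<in> Obj X \<Longrightarrow> A \<odot> I = A"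
  by (simp_all add: unit_Obj tensor_Obj tensor_obj_assoc obj_unit_left obj_unit_right)

lemma tensor_typing [simp]:
  assumes "f \<in> Arr X" "g \<in> Arr X"
  shows "f \<otimes> g \<in> Arr X" "Dom X (f \<otimes> g) = Dom X f \<odot> Dom X g"
    "Cod X (f \<otimes> g) = Cod X f \<odot> Cod X g"
  using tensor_Hom[of f "Dom X f" "Cod X f" g "Dom X g" "Cod X g"] assms
  by (simp_all add: Hom_iff)

lemma sym_typing [simp]:
  assumes "A \<in> Obj X" "B \<in> Obj X"
  shows "\<sigma> A B \<in> Arr X" "Dom X (\<sigma> A B) = A \<odot> B" "Cod X (\<sigma> A B) = B \<odot> A"
  using sym_Hom[OF assms] by (simp_all add: Hom_iff)

lemma tensor_simps [simp]:
  "A \<in> Obj X \<Longrightarrow> B \<in> Obj X \<Longrightarrow> \<one> A \<otimes> \<one> B = \<one> (A \<odot> B)"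
  "f \<in> Arr X \<Longrightarrow> \<one> I \<otimes> f = f"
  "f \<in> Arr X \<Longrightarrow> f \<otimes> \<one> I = f"
  by (simp_all add: tensor_ident arr_unit_left arr_unit_right)

text \<open>
  Used from left to right, this law merges layers of a string diagram.  Where a layer has to be
  split in another way, the intended form is written out and checked by the same rule.
\<close>

lemma interchange [simp]:
  "f \<in> Arr X \<Longrightarrow> f' \<in> Arr X \<Longrightarrow> g \<in> Arr X \<Longrightarrow> g' \<in> Arr X \<Longrightarrow> Cod X f = Dom X f' \<Longrightarrow>
    Cod X g = Dom X g' \<Longrightarrow> (f \<otimes> g) \<cdot> (f' \<otimes> g') = (f \<cdot> f') \<otimes> (g \<cdot> g')"
  using tensor_comp[of f "Dom X f" "Cod X f" f' "Cod X f'" g "Dom X g" "Cod X g" g' "Cod X g'"]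
  by (simp add: Hom_iff)

lemma interchange_tail [simp]:
  assumes "f \<in> Arr X" "f' \<in> Arr X" "g \<in> Arr X" "g' \<in> Arr X" "h \<in> Arr X"
    "Cod X f = Dom X f'" "Cod X g = Dom X g'" "Cod X f' \<odot> Cod X g' = Dom X h"
  shows "(f \<otimes> g) \<cdot> ((f' \<otimes> g') \<cdot> h) = ((f \<cdot> f') \<otimes> (g \<cdot> g')) \<cdot> h"
  by (rule comp_eq_tail) (simp_all add: assms)

text \<open>
  Naturality of the shuffle that interchanges the two middle factors of a fourfold tensor
  product.
\<close>

lemma middle_interchange:
  assumes "f \<in> Hom X A A'" "g \<in> Hom X B B'" "h \<in> Hom X C C'" "k \<in> Hom X D D'"
  shows "((f \<otimes> g) \<otimes> (h \<otimes> k)) \<cdot> (\<one> A' \<otimes> \<sigma> B' C' \<otimes> \<one> D')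
    = (\<one> A \<otimes> \<sigma> B C \<otimes> \<one> D) \<cdot> ((f \<otimes> h) \<otimes> (g \<otimes> k))"
proof -
  note [simp] = Hom_Obj[OF assms(1)] Hom_Obj[OF assms(2)] Hom_Obj[OF assms(3)] Hom_Obj[OF assms(4)]
  note ty [simp] = assms[unfolded Hom_iff]
  have 1: "(f \<otimes> g) \<otimes> (h \<otimes> k) = f \<otimes> (g \<otimes> h) \<otimes> k" "(f \<otimes> h) \<otimes> (g \<otimes> k) = f \<otimes> (h \<otimes> g) \<otimes> k"
    by (simp_all add: tensor_assoc)
  show ?thesis unfolding 1 using sym_natural[OF assms(2,3)] by simp
qed

end

context additive_symmetric_monoidal_category
begin

lemma zero_typing [simp]:
  assumes "A \<in> Obj X" "B \<in> Obj X"
  shows "\<zero> A B \<in> Arr X" "Dom X (\<zero> A B) = A" "Cod X (\<zero> A B) = B"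
  using zero_Hom[OF assms] by (simp_all add: Hom_iff)

lemma plus_typing [simp]:
  assumes "f \<in> Arr X" "g \<in> Arr X" "Dom X f = Dom X g" "Cod X f = Cod X g"
  shows "f \<oplus> g \<in> Arr X" "Dom X (f \<oplus> g) = Dom X g" "Cod X (f \<oplus> g) = Cod X g"
  using plus_Hom[of f "Dom X f" "Cod X f" g] assms by (simp_all add: Hom_iff)

lemma plus_zero [simp]:
  "f \<in> Arr X \<Longrightarrow> Dom X f = A \<Longrightarrow> Cod X f = B \<Longrightarrow> f \<oplus> \<zero> A B = f"
  "f \<in> Arr X \<Longrightarrow> Dom X f = A \<Longrightarrow> Cod X f = B \<Longrightarrow> \<zero> A B \<oplus> f = f"
  using zero_plus[of f A B] plus_commute[of f A B "\<zero> A B"] by (auto simp: Hom_iff)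

lemma comp_zero_simps [simp]:
  assumes "f \<in> Arr X" "C \<in> Obj X"
  shows "Cod X f = B \<Longrightarrow> f \<cdot> \<zero> B C = \<zero> (Dom X f) C"
    "Dom X f = B \<Longrightarrow> \<zero> C B \<cdot> f = \<zero> C (Cod X f)"
  using comp_zero[of f "Dom X f" "Cod X f" "\<one> C" C C]
    comp_zero[of "\<one> C" C C f "Dom X f" "Cod X f"] assms
  by (auto simp: Hom_iff)

lemma comp_plus_left:
  assumes "f \<in> Arr X" "g \<in> Arr X" "h \<in> Arr X" "Dom X f = Dom X g" "Cod X f = Cod X g"
    "Cod X g = Dom X h"
  shows "(f \<oplus> g) \<cdot> h = f \<cdot> h \<oplus> g \<cdot> h"
  using comp_plus[of "\<one> (Dom X f)" "Dom X f" "Dom X f" f "Cod X f" g h "Cod X h"] assms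
  by (simp add: Hom_iff)

lemma comp_plus_right:
  assumes "f \<in> Arr X" "g \<in> Arr X" "h \<in> Arr X" "Dom X f = Dom X g" "Cod X f = Cod X g"
    "Cod X h = Dom X g"
  shows "h \<cdot> (f \<oplus> g) = h \<cdot> f \<oplus> h \<cdot> g"
  using comp_plus[of h "Dom X h" "Cod X h" f "Cod X f" g "\<one> (Cod X f)" "Cod X f"] assms
  by (simp add: Hom_iff)

lemma tensor_plus_right:
  assumes "f \<in> Arr X" "g \<in> Arr X" "h \<in> Arr X" "Dom X f = Dom X g" "Cod X f = Cod X g"
  shows "h \<otimes> (f \<oplus> g) = h \<otimes> f \<oplus> h \<otimes> g"
  using tensor_plus[of h "Dom X h" "Cod X h" f "Dom X f" "Cod X f" g "\<one> I" I I] assms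
  by (simp add: Hom_iff)

lemma tensor_zero_simps [simp]:
  assumes "f \<in> Arr X" "A \<in> Obj X" "B \<in> Obj X"
  shows "f \<otimes> \<zero> A B = \<zero> (Dom X f \<odot> A) (Cod X f \<odot> B)"
    "\<zero> A B \<otimes> f = \<zero> (A \<odot> Dom X f) (B \<odot> Cod X f)"
  using tensor_zero[of f "Dom X f" "Cod X f" A B "\<one> I" I I]
    tensor_zero[of "\<one> I" I I A B f "Dom X f" "Cod X f"] assms
  by (simp_all add: Hom_iff)

end

context comonad
begin

lemma bang_typing [simp]:
  assumes "f \<in> Arr X"
  shows "F' f \<in> Arr X" "Dom X (F' f) = F (Dom X f)" "Cod X (F' f) = F (Cod X f)"
  using map_Hom[of f "Dom X f" "Cod X f"] assms by (simp_all add: Hom_iff)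

lemma Bang_Obj [simp]: "A \<in> Obj X \<Longrightarrow> F A \<in> Obj X"
  by (rule map_Obj)

lemma bang_simps [simp]:
  "A \<in> Obj X \<Longrightarrow> F' (\<one> A) = \<one> (F A)"
  "f \<in> Arr X \<Longrightarrow> g \<in> Arr X \<Longrightarrow> Cod X f = Dom X g \<Longrightarrow> F' (f \<cdot> g) = F' f \<cdot> F' g"
  using map_comp[of f "Dom X f" "Cod X f" g "Cod X g"] by (simp_all add: map_ident Hom_iff)

lemma rho_typing [simp]:
  assumes "A \<in> Obj X"
  shows "\<rho> A \<in> Arr X" "Dom X (\<rho> A) = F A" "Cod X (\<rho> A) = F (F A)"
  using rho_natural assms by (auto simp: natural_transformation_def Hom_iff)

lemma eps_typing [simp]:
  assumes "A \<in> Obj X"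
  shows "\<epsilon> A \<in> Arr X" "Dom X (\<epsilon> A) = F A" "Cod X (\<epsilon> A) = A"
  using eps_natural assms by (auto simp: natural_transformation_def Hom_iff)

lemma rho_nat: "f \<in> Hom X A B \<Longrightarrow> F' f \<cdot> \<rho> B = \<rho> A \<cdot> F' (F' f)"
  using rho_natural unfolding natural_transformation_def by blast

lemma eps_nat: "f \<in> Hom X A B \<Longrightarrow> F' f \<cdot> \<epsilon> B = \<epsilon> A \<cdot> f"
  using eps_natural unfolding natural_transformation_def by blast

end

context coalgebra_modality
begin

lemma Delta_typing [simp]:
  assumes "A \<in> Obj X"
  shows "\<Delta> A \<in> Arr X" "Dom X (\<Delta> A) = Bang A" "Cod X (\<Delta> A) = Bang A \<odot> Bang A"
  using Delta_natural assms by (auto simp: natural_transformation_def Hom_iff)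

lemma e_typing [simp]:
  assumes "A \<in> Obj X"
  shows "e A \<in> Arr X" "Dom X (e A) = Bang A" "Cod X (e A) = I"
  using e_natural assms by (auto simp: natural_transformation_def Hom_iff)

lemma Delta_nat: "f \<in> Hom X A B \<Longrightarrow> bang f \<cdot> \<Delta> B = \<Delta> A \<cdot> (bang f \<otimes> bang f)"
  using Delta_natural unfolding natural_transformation_def by blast

lemma e_nat:
  assumes "f \<in> Hom X A B"
  shows "bang f \<cdot> e B = e A"
proof -
  have "bang f \<cdot> e B = e A \<cdot> \<one> I"
    using e_natural assms unfolding natural_transformation_def by blast
  then show ?thesis using Hom_Obj[OF assms] by simp
qed

lemma comonoid_counits:
  assumes "A \<in> Obj X"
  shows Delta_counit_left: "\<Delta> A \<cdot> (e A \<otimes> \<one> (Bang A)) = \<one> (Bang A)"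
    and Delta_counit_right: "\<Delta> A \<cdot> (\<one> (Bang A) \<otimes> e A) = \<one> (Bang A)"
  using comonoid[OF assms] by (simp_all add: cocommutative_comonoid_def)

end

section \<open>The coalgebra structure of a tensor product\<close>

context monoidal_coalgebra_modality
begin

lemma m_typing [simp]:
  assumes "A \<in> Obj X" "B \<in> Obj X"
  shows "m A B \<in> Arr X" "Dom X (m A B) = Bang A \<odot> Bang B" "Cod X (m A B) = Bang (A \<odot> B)"
  using m_Hom[OF assms] by (simp_all add: Hom_iff)

lemma mI_typing [simp]:
  shows "m\<^sub>I \<in> Arr X" "Dom X m\<^sub>I = I" "Cod X m\<^sub>I = Bang I"
  using mI_Hom by (simp_all add: Hom_iff)

text \<open>
  The comultiplication of \<open>!A \<otimes> !B\<close>, as a tensor product of comonoids; its counit is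
  \<open>e A \<otimes> e B\<close>.
\<close>

definition tensor_comult where
  "tensor_comult A B =
    (\<Delta> A \<otimes> \<Delta> B) \<cdot> (\<one> (Bang A) \<otimes> \<sigma> (Bang A) (Bang B) \<otimes> \<one> (Bang B))"

text \<open>
  The coalgebra structure of \<open>!A \<otimes> !B\<close>.  With it, \<open>!A \<otimes> !B\<close> is the product of the cofree coalgebras
  \<open>!A\<close> and \<open>!B\<close>.
\<close>

definition tensor_coalg where
  "tensor_coalg A B = (\<rho> A \<otimes> \<rho> B) \<cdot> m (Bang A) (Bang B)"

lemma tensor_comult_typing [simp]:
  assumes "A \<in> Obj X" "B \<in> Obj X"
  shows "tensor_comult A B \<in> Arr X" "Dom X (tensor_comult A B) = Bang A \<odot> Bang B"
    "Cod X (tensor_comult A B) = Bang A \<odot> (Bang B \<odot> (Bang A \<odot> Bang B))"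
  using assms by (simp_all add: tensor_comult_def)

lemma tensor_coalg_typing [simp]:
  assumes "A \<in> Obj X" "B \<in> Obj X"
  shows "tensor_coalg A B \<in> Arr X" "Dom X (tensor_coalg A B) = Bang A \<odot> Bang B"
    "Cod X (tensor_coalg A B) = Bang (Bang A \<odot> Bang B)"
  using assms by (simp_all add: tensor_coalg_def)

lemma tensor_coalg_rho:
  assumes [simp]: "A \<in> Obj X" "B \<in> Obj X"
  shows "tensor_coalg A B \<cdot> \<rho> (Bang A \<odot> Bang B) = tensor_coalg A B \<cdot> bang (tensor_coalg A B)"
proof -
  have "m (Bang A) (Bang B) \<cdot> bang (\<rho> A \<otimes> \<rho> B)
      = (bang (\<rho> A) \<otimes> bang (\<rho> B)) \<cdot> m (Bang (Bang A)) (Bang (Bang B))"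
    by (rule m_natural[symmetric]) (simp_all add: Hom_iff)
  note nat = comp_eq_tail[OF this]
  show ?thesis
    by (simp add: tensor_coalg_def m_rho nat rho_coassoc)
qed

text \<open>
  A composite of comonoid morphisms: \<open>\<rho>\<close> and \<open>m\<close> preserve the comultiplications, and the shuffle
  in \<open>tensor_comult\<close> is natural.
\<close>

lemma tensor_coalg_comult:
  assumes [simp]: "A \<in> Obj X" "B \<in> Obj X"
  shows "tensor_coalg A B \<cdot> \<Delta> (Bang A \<odot> Bang B)
    = tensor_comult A B \<cdot> (tensor_coalg A B \<otimes> tensor_coalg A B)"
proof -
  let ?s = "\<lambda>A B. \<one> (Bang A) \<otimes> \<sigma> (Bang A) (Bang B) \<otimes> \<one> (Bang B)"
  have "tensor_coalg A B \<cdot> \<Delta> (Bang A \<odot> Bang B)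
      = (\<Delta> A \<otimes> \<Delta> B) \<cdot> (((\<rho> A \<otimes> \<rho> A) \<otimes> (\<rho> B \<otimes> \<rho> B)) \<cdot> ?s (Bang A) (Bang B))
        \<cdot> (m (Bang A) (Bang B) \<otimes> m (Bang A) (Bang B))"
    by (simp add: tensor_coalg_def m_Delta rho_Delta)
  also have "((\<rho> A \<otimes> \<rho> A) \<otimes> (\<rho> B \<otimes> \<rho> B)) \<cdot> ?s (Bang A) (Bang B)
      = ?s A B \<cdot> ((\<rho> A \<otimes> \<rho> B) \<otimes> (\<rho> A \<otimes> \<rho> B))"
    by (rule middle_interchange) (simp_all add: Hom_iff)
  finally show ?thesis
    by (simp add: tensor_coalg_def tensor_comult_def)
qed

text \<open>
  A coalgebra morphism into a cofree \<open>!A\<close> is determined by its composite with \<open>\<epsilon>\<close>, and it is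
  recovered from that composite by applying \<open>!\<close> to it after the structure map.  The next three
  lemmas do this for the projections of the product \<open>!A \<otimes> !B\<close> and for \<open>m A B\<close>.
\<close>

lemma tensor_coalg_eps_e:
  assumes [simp]: "A \<in> Obj X" "B \<in> Obj X"
  shows "tensor_coalg A B \<cdot> bang (\<epsilon> A \<otimes> e B) = \<one> (Bang A) \<otimes> e B"
proof -
  have 1: "m (Bang A) (Bang B) \<cdot> bang (\<epsilon> A \<otimes> e B) = (bang (\<epsilon> A) \<otimes> bang (e B)) \<cdot> m A I"
    by (rule m_natural[symmetric]) (simp_all add: Hom_iff)
  have "tensor_coalg A B \<cdot> bang (\<epsilon> A \<otimes> e B) = (\<one> (Bang A) \<otimes> (e B \<cdot> m\<^sub>I)) \<cdot> m A I"
    using 1 by (simp add: tensor_coalg_def rho_map_eps e_coalgebra)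
  also have "\<one> (Bang A) \<otimes> (e B \<cdot> m\<^sub>I) = (\<one> (Bang A) \<otimes> e B) \<cdot> (\<one> (Bang A) \<otimes> m\<^sub>I)"
    by simp
  finally show ?thesis
    by (simp add: m_unit_right del: interchange interchange_tail)
qed

lemma tensor_coalg_e_eps:
  assumes [simp]: "A \<in> Obj X" "B \<in> Obj X"
  shows "tensor_coalg A B \<cdot> bang (e A \<otimes> \<epsilon> B) = e A \<otimes> \<one> (Bang B)"
proof -
  have 1: "m (Bang A) (Bang B) \<cdot> bang (e A \<otimes> \<epsilon> B) = (bang (e A) \<otimes> bang (\<epsilon> B)) \<cdot> m I B"
    by (rule m_natural[symmetric]) (simp_all add: Hom_iff)
  have "tensor_coalg A B \<cdot> bang (e A \<otimes> \<epsilon> B) = ((e A \<cdot> m\<^sub>I) \<otimes> \<one> (Bang B)) \<cdot> m I B"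
    using 1 by (simp add: tensor_coalg_def rho_map_eps e_coalgebra)
  also have "(e A \<cdot> m\<^sub>I) \<otimes> \<one> (Bang B) = (e A \<otimes> \<one> (Bang B)) \<cdot> (m\<^sub>I \<otimes> \<one> (Bang B))"
    by simp
  finally show ?thesis
    by (simp add: m_unit_left del: interchange interchange_tail)
qed

lemma tensor_coalg_eps_eps:
  assumes [simp]: "A \<in> Obj X" "B \<in> Obj X"
  shows "tensor_coalg A B \<cdot> bang (\<epsilon> A \<otimes> \<epsilon> B) = m A B"
proof -
  have "m (Bang A) (Bang B) \<cdot> bang (\<epsilon> A \<otimes> \<epsilon> B) = (bang (\<epsilon> A) \<otimes> bang (\<epsilon> B)) \<cdot> m A B"
    by (rule m_natural[symmetric]) (simp_all add: Hom_iff)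
  then show ?thesis
    by (simp add: tensor_coalg_def rho_map_eps)
qed

lemma tensor_comult_counits:
  assumes [simp]: "A \<in> Obj X" "B \<in> Obj X"
  shows "tensor_comult A B \<cdot> ((\<one> (Bang A) \<otimes> e B) \<otimes> (e A \<otimes> \<one> (Bang B))) = \<one> (Bang A \<odot> Bang B)"
proof -
  have "(\<one> (Bang A) \<otimes> \<sigma> (Bang A) (Bang B) \<otimes> \<one> (Bang B))
        \<cdot> ((\<one> (Bang A) \<otimes> e B) \<otimes> (e A \<otimes> \<one> (Bang B)))
      = ((\<one> (Bang A) \<otimes> e A) \<otimes> (e B \<otimes> \<one> (Bang B))) \<cdot> (\<one> (Bang A) \<otimes> \<sigma> I I \<otimes> \<one> (Bang B))"
    by (rule middle_interchange[symmetric]) (simp_all add: Hom_iff)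
  then show ?thesis
    by (simp add: tensor_comult_def sym_unit Delta_counit_left Delta_counit_right)
qed

text \<open>
  Two maps \<open>p : W \<rightarrow> A\<close> and \<open>q : W \<rightarrow> B\<close> induce \<open>\<Delta>\<^sub>W (!p \<otimes> !q) : !W \<rightarrow> !A \<otimes> !B\<close>, the comparison map
  of the Seely isomorphism when \<open>W\<close> is a product.  It is a coalgebra morphism because \<open>\<Delta>\<close> is one.
\<close>

lemma split_coalg:
  assumes [simp]: "p \<in> Hom X W A" "q \<in> Hom X W B"
  shows "(\<Delta> W \<cdot> (bang p \<otimes> bang q)) \<cdot> tensor_coalg A B
    = \<rho> W \<cdot> bang (\<Delta> W \<cdot> (bang p \<otimes> bang q))"
proof -
  note [simp] = Hom_Obj[OF assms(1)] Hom_Obj[OF assms(2)]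
  note ty [simp] = assms[unfolded Hom_iff]
  have nat: "(bang (bang p) \<otimes> bang (bang q)) \<cdot> m (Bang A) (Bang B)
      = m (Bang W) (Bang W) \<cdot> bang (bang p \<otimes> bang q)"
    by (rule m_natural) (simp_all add: Hom_iff)
  have "\<rho> W \<cdot> bang (\<Delta> W \<cdot> (bang p \<otimes> bang q)) = (\<rho> W \<cdot> bang (\<Delta> W)) \<cdot> bang (bang p \<otimes> bang q)"
    by simp
  also have "\<dots> = \<Delta> W \<cdot> (\<rho> W \<otimes> \<rho> W) \<cdot> (m (Bang W) (Bang W) \<cdot> bang (bang p \<otimes> bang q))"
    by (simp add: Delta_coalgebra del: interchange_tail)
  also have "\<dots> = \<Delta> W \<cdot> ((\<rho> W \<cdot> bang (bang p)) \<otimes> (\<rho> W \<cdot> bang (bang q))) \<cdot> m (Bang A) (Bang B)"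
    unfolding nat[symmetric] by simp
  also have "\<dots> = (\<Delta> W \<cdot> (bang p \<otimes> bang q)) \<cdot> tensor_coalg A B"
    by (simp add: tensor_coalg_def rho_nat[OF assms(1)] rho_nat[OF assms(2)])
  finally show ?thesis by simp
qed

lemma split_eps_e:
  assumes "p \<in> Hom X W A" "q \<in> Hom X W B"
  shows "(\<Delta> W \<cdot> (bang p \<otimes> bang q)) \<cdot> (\<epsilon> A \<otimes> e B) = \<epsilon> W \<cdot> p"
proof -
  note [simp] = Hom_Obj[OF assms(1)] Hom_Obj[OF assms(2)]
  note ty [simp] = assms[unfolded Hom_iff]
  have "(\<Delta> W \<cdot> (bang p \<otimes> bang q)) \<cdot> (\<epsilon> A \<otimes> e B)
      = \<Delta> W \<cdot> ((\<one> (Bang W) \<otimes> e W) \<cdot> ((\<epsilon> W \<cdot> p) \<otimes> \<one> I))"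
    by (subst interchange) (simp_all add: eps_nat[OF assms(1)] e_nat[OF assms(2)])
  also have "\<dots> = \<epsilon> W \<cdot> p"
    by (subst comp_eq_tail[OF Delta_counit_right]) simp_all
  finally show ?thesis .
qed

lemma split_e_eps:
  assumes "p \<in> Hom X W A" "q \<in> Hom X W B"
  shows "(\<Delta> W \<cdot> (bang p \<otimes> bang q)) \<cdot> (e A \<otimes> \<epsilon> B) = \<epsilon> W \<cdot> q"
proof -
  note [simp] = Hom_Obj[OF assms(1)] Hom_Obj[OF assms(2)]
  note ty [simp] = assms[unfolded Hom_iff]
  have "(\<Delta> W \<cdot> (bang p \<otimes> bang q)) \<cdot> (e A \<otimes> \<epsilon> B)
      = \<Delta> W \<cdot> ((e W \<otimes> \<one> (Bang W)) \<cdot> (\<one> I \<otimes> (\<epsilon> W \<cdot> q)))"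
    by (subst interchange) (simp_all add: e_nat[OF assms(1)] eps_nat[OF assms(2)])
  also have "\<dots> = \<epsilon> W \<cdot> q"
    by (subst comp_eq_tail[OF Delta_counit_left]) simp_all
  finally show ?thesis .
qed

end
section \<open>Differentiation on a tensor product of cofree coalgebras\<close>

context differential_category
begin

lemma d_typing [simp]:
  assumes "A \<in> Obj X"
  shows "d A \<in> Arr X" "Dom X (d A) = Bang A \<odot> A" "Cod X (d A) = Bang A"
  using d_natural assms by (auto simp: natural_transformation_def Hom_iff)

lemma d_nat: "f \<in> Hom X A B \<Longrightarrow> (bang f \<otimes> f) \<cdot> d B = d A \<cdot> bang f"
  using d_natural unfolding natural_transformation_def by blast

end

text \<open>
  A biproduct diagram without the condition that \<open>p \<cdot> i \<oplus> q \<cdot> k\<close> is the identity of \<open>W\<close>; this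
  sum is merely idempotent.
\<close>

definition weak_biproduct ::
  "('o, 'a, 'z) asmc_scheme \<Rightarrow> 'o \<Rightarrow> 'o \<Rightarrow> 'o \<Rightarrow> 'a \<Rightarrow> 'a \<Rightarrow> 'a \<Rightarrow> 'a \<Rightarrow> bool"
where
  "weak_biproduct X A B W p q i k \<longleftrightarrow>
     p \<in> Hom X W A \<and> q \<in> Hom X W B \<and> i \<in> Hom X A W \<and> k \<in> Hom X B W \<and>
     i \<cdot>\<^bsub>X\<^esub> p = \<one>\<^bsub>X\<^esub> A \<and> k \<cdot>\<^bsub>X\<^esub> q = \<one>\<^bsub>X\<^esub> B \<and>
     i \<cdot>\<^bsub>X\<^esub> q = \<zero>\<^bsub>X\<^esub> A B \<and> k \<cdot>\<^bsub>X\<^esub> p = \<zero>\<^bsub>X\<^esub> B A"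

context differential_linear_category
begin

text \<open>
  The inclusion of the constants into \<open>!A\<close>, which is the unit of the bialgebra structure of \<open>!A\<close>.
\<close>

definition bialg_unit where "bialg_unit A = m\<^sub>I \<cdot> bang (\<zero> I A)"

text \<open>
  Differentiation at zero; it is a section of \<open>\<epsilon> A\<close>, by linearity of \<open>d\<close>.
\<close>

definition codereliction where "codereliction A = (bialg_unit A \<otimes> \<one> A) \<cdot> d A"

lemma codereliction_laws:
  assumes [simp]: "A \<in> Obj X"
  shows "bialg_unit A \<in> Arr X" "Dom X (bialg_unit A) = I" "Cod X (bialg_unit A) = Bang A"
    "codereliction A \<in> Arr X" "Dom X (codereliction A) = A" "Cod X (codereliction A) = Bang A"
    "bialg_unit A \<cdot> e A = \<one> I" "bialg_unit A \<cdot> \<epsilon> A = \<zero> I A"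
    "codereliction A \<cdot> e A = \<zero> A I" "codereliction A \<cdot> \<epsilon> A = \<one> A"
proof -
  have z: "\<zero> I A \<in> Hom X I A" by (simp add: Hom_iff)
  show [simp]: "bialg_unit A \<in> Arr X" "Dom X (bialg_unit A) = I"
    "Cod X (bialg_unit A) = Bang A"
    by (simp_all add: bialg_unit_def)
  show "codereliction A \<in> Arr X" "Dom X (codereliction A) = A" "Cod X (codereliction A) = Bang A"
    by (simp_all add: codereliction_def)
  show ue: "bialg_unit A \<cdot> e A = \<one> I"
    by (simp add: bialg_unit_def e_nat[OF z] mI_e)
  show "bialg_unit A \<cdot> \<epsilon> A = \<zero> I A"
    by (simp add: bialg_unit_def eps_nat[OF z])
  show "codereliction A \<cdot> e A = \<zero> A I"
    by (simp add: codereliction_def d_constant)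
  show "codereliction A \<cdot> \<epsilon> A = \<one> A"
    by (simp add: codereliction_def d_linear ue)
qed

text \<open>
  The object \<open>!A \<otimes> !B\<close> contains \<open>A\<close> as \<open>A \<otimes> constants\<close> and \<open>B\<close> as \<open>constants \<otimes> B\<close>.
\<close>

lemma weak_biproduct_Bang_tensor:
  assumes [simp]: "A \<in> Obj X" "B \<in> Obj X"
  shows "weak_biproduct X A B (Bang A \<odot> Bang B) (\<epsilon> A \<otimes> e B) (e A \<otimes> \<epsilon> B)
    (codereliction A \<otimes> bialg_unit B) (bialg_unit A \<otimes> codereliction B)"
  by (simp add: weak_biproduct_def Hom_iff codereliction_laws)

text \<open>
  The coalgebra morphism \<open>!A \<otimes> !B \<rightarrow> !W\<close> whose composite with \<open>\<epsilon>\<close> is the sum of the two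
  projections followed by the injections \<open>i\<close> and \<open>k\<close>.
\<close>

definition merge where
  "merge A B i k = tensor_coalg A B \<cdot> bang ((\<epsilon> A \<otimes> e B) \<cdot> i \<oplus> (e A \<otimes> \<epsilon> B) \<cdot> k)"

context
  fixes A B W p q i k
  assumes wb: "weak_biproduct X A B W p q i k"
begin

lemma wb_Hom:
  "p \<in> Hom X W A" "q \<in> Hom X W B" "i \<in> Hom X A W" "k \<in> Hom X B W"
  using wb by (simp_all add: weak_biproduct_def)

lemma wb_typing [simp]:
  "A \<in> Obj X" "B \<in> Obj X" "W \<in> Obj X"
  "p \<in> Arr X" "Dom X p = W" "Cod X p = A"
  "q \<in> Arr X" "Dom X q = W" "Cod X q = B"
  "i \<in> Arr X" "Dom X i = A" "Cod X i = W"
  "k \<in> Arr X" "Dom X k = B" "Cod X k = W"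
  using wb_Hom Hom_Obj[OF wb_Hom(1)] Hom_Obj[OF wb_Hom(2)] by (simp_all add: Hom_iff)

lemma wb_laws [simp]:
  "i \<cdot> p = \<one> A" "k \<cdot> q = \<one> B" "i \<cdot> q = \<zero> A B" "k \<cdot> p = \<zero> B A"
  using wb by (simp_all add: weak_biproduct_def)

lemma merge_typing [simp]:
  "merge A B i k \<in> Arr X" "Dom X (merge A B i k) = Bang A \<odot> Bang B"
  "Cod X (merge A B i k) = Bang W"
  by (simp_all add: merge_def)

lemma merge_proj_left: "merge A B i k \<cdot> bang p = \<one> (Bang A) \<otimes> e B"
proof -
  have 1: "((\<epsilon> A \<otimes> e B) \<cdot> i \<oplus> (e A \<otimes> \<epsilon> B) \<cdot> k) \<cdot> p = \<epsilon> A \<otimes> e B"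
    by (simp add: comp_plus_left)
  have "merge A B i k \<cdot> bang p
      = tensor_coalg A B \<cdot> bang (((\<epsilon> A \<otimes> e B) \<cdot> i \<oplus> (e A \<otimes> \<epsilon> B) \<cdot> k) \<cdot> p)"
    by (simp add: merge_def)
  then show ?thesis unfolding 1 by (simp add: tensor_coalg_eps_e)
qed

lemma merge_proj_right: "merge A B i k \<cdot> bang q = e A \<otimes> \<one> (Bang B)"
proof -
  have 1: "((\<epsilon> A \<otimes> e B) \<cdot> i \<oplus> (e A \<otimes> \<epsilon> B) \<cdot> k) \<cdot> q = e A \<otimes> \<epsilon> B"
    by (simp add: comp_plus_left)
  have "merge A B i k \<cdot> bang q
      = tensor_coalg A B \<cdot> bang (((\<epsilon> A \<otimes> e B) \<cdot> i \<oplus> (e A \<otimes> \<epsilon> B) \<cdot> k) \<cdot> q)"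
    by (simp add: merge_def)
  then show ?thesis unfolding 1 by (simp add: tensor_coalg_e_eps)
qed

lemma merge_comult:
  "merge A B i k \<cdot> \<Delta> W = tensor_comult A B \<cdot> (merge A B i k \<otimes> merge A B i k)"
proof -
  let ?f = "(\<epsilon> A \<otimes> e B) \<cdot> i \<oplus> (e A \<otimes> \<epsilon> B) \<cdot> k"
  have f: "?f \<in> Hom X (Bang A \<odot> Bang B) W" by (simp add: Hom_iff)
  have "merge A B i k \<cdot> \<Delta> W
      = (tensor_coalg A B \<cdot> \<Delta> (Bang A \<odot> Bang B)) \<cdot> (bang ?f \<otimes> bang ?f)"
    by (simp add: merge_def Delta_nat[OF f])
  also have "\<dots> = tensor_comult A B \<cdot> (merge A B i k \<otimes> merge A B i k)"
    unfolding tensor_coalg_comult[OF wb_typing(1,2)] by (simp add: merge_def)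
  finally show ?thesis .
qed

abbreviation (input) split where "split \<equiv> \<Delta> W \<cdot> (bang p \<otimes> bang q)"

text \<open>
  For a genuine biproduct, \<open>merge\<close> and \<open>split\<close> are mutually inverse.  Here \<open>merge\<close> is still a section
  of \<open>split\<close>, and the opposite composite is \<open>!\<close> of the idempotent.
\<close>

lemma merge_split: "merge A B i k \<cdot> split = \<one> (Bang A \<odot> Bang B)"
proof -
  have "merge A B i k \<cdot> split = (merge A B i k \<cdot> \<Delta> W) \<cdot> (bang p \<otimes> bang q)"
    by simp
  then show ?thesis
    by (simp add: merge_comult merge_proj_left merge_proj_right
        tensor_comult_counits del: tensor_simps(2,3))
qed

lemma split_merge: "split \<cdot> merge A B i k = bang (p \<cdot> i \<oplus> q \<cdot> k)"
proof -
  let ?f = "(\<epsilon> A \<otimes> e B) \<cdot> i \<oplus> (e A \<otimes> \<epsilon> B) \<cdot> k"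
  have "split \<cdot> ?f = (split \<cdot> (\<epsilon> A \<otimes> e B)) \<cdot> i \<oplus> (split \<cdot> (e A \<otimes> \<epsilon> B)) \<cdot> k"
    by (simp add: comp_plus_right)
  also have "\<dots> = \<epsilon> W \<cdot> (p \<cdot> i \<oplus> q \<cdot> k)"
    unfolding split_eps_e[OF wb_Hom(1,2)] split_e_eps[OF wb_Hom(1,2)]
    by (simp add: comp_plus_right)
  finally have f: "split \<cdot> ?f = \<epsilon> W \<cdot> (p \<cdot> i \<oplus> q \<cdot> k)" .
  have "split \<cdot> merge A B i k = (split \<cdot> tensor_coalg A B) \<cdot> bang ?f"
    by (simp add: merge_def)
  also have "\<dots> = \<rho> W \<cdot> bang (split \<cdot> ?f)"
    unfolding split_coalg[OF wb_Hom(1,2)] by simp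
  also have "\<dots> = (\<rho> W \<cdot> bang (\<epsilon> W)) \<cdot> bang (p \<cdot> i \<oplus> q \<cdot> k)"
    unfolding f by simp
  finally show ?thesis by (simp add: rho_map_eps)
qed

text \<open>
  Since \<open>merge\<close> is a coalgebra morphism, the coalgebra structure of \<open>!A \<otimes> !B\<close> can be computed
  in \<open>!W\<close>.
\<close>

lemma merge_rho_split: "merge A B i k \<cdot> \<rho> W \<cdot> bang split = tensor_coalg A B"
proof -
  let ?f = "(\<epsilon> A \<otimes> e B) \<cdot> i \<oplus> (e A \<otimes> \<epsilon> B) \<cdot> k"
  have f: "?f \<in> Hom X (Bang A \<odot> Bang B) W" by (simp add: Hom_iff)
  have "merge A B i k \<cdot> \<rho> W = (tensor_coalg A B \<cdot> \<rho> (Bang A \<odot> Bang B)) \<cdot> bang (bang ?f)"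
    by (simp add: merge_def rho_nat[OF f])
  also have "\<dots> = tensor_coalg A B \<cdot> bang (merge A B i k)"
    unfolding tensor_coalg_rho[OF wb_typing(1,2)] by (simp add: merge_def)
  finally have "merge A B i k \<cdot> \<rho> W \<cdot> bang split = tensor_coalg A B \<cdot> bang (merge A B i k \<cdot> split)"
    by simp
  then show ?thesis unfolding merge_split by simp
qed

text \<open>
  In the product rule for \<open>d\<^sub>W \<Delta>\<^sub>W\<close> only the term that differentiates the second factor
  survives: in the other term \<open>!p\<close> turns the direction \<open>k\<close> of differentiation into \<open>k \<cdot> p = 0\<close>.
\<close>

lemma d_split: "(merge A B i k \<otimes> k) \<cdot> d W \<cdot> split = \<one> (Bang A) \<otimes> d B"
proof -
  let ?j = "merge A B i k"
  have p: "(\<one> (Bang W) \<otimes> k) \<cdot> (d W \<cdot> bang p) = \<zero> (Bang W \<odot> B) (Bang A)"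
    by (simp add: d_nat[OF wb_Hom(1), symmetric])
  have nat: "(\<one> (Bang W) \<otimes> k) \<cdot> \<sigma> (Bang W) W = \<sigma> (Bang W) B \<cdot> (k \<otimes> \<one> (Bang W))"
    by (rule sym_natural) (simp_all add: Hom_iff)
  \<comment> \<open>First term of the product rule: move \<open>k\<close> past the copy and the symmetry, next to \<open>d W\<close>.\<close>
  have "\<one> (Bang W) \<otimes> (\<one> (Bang W) \<otimes> k) = \<one> (Bang W \<odot> Bang W) \<otimes> k"
    by (simp flip: tensor_assoc)
  then have "((?j \<cdot> \<Delta> W) \<otimes> \<one> B) \<cdot> (\<one> (Bang W) \<otimes> (\<one> (Bang W) \<otimes> k)) = (?j \<cdot> \<Delta> W) \<otimes> k"
    by simp
  then have slide: "(?j \<otimes> k) \<cdot> (\<Delta> W \<otimes> \<one> W)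
      = ((?j \<cdot> \<Delta> W) \<otimes> \<one> B) \<cdot> (\<one> (Bang W) \<otimes> (\<one> (Bang W) \<otimes> k))"
    by simp
  have "(\<one> (Bang W) \<otimes> (\<one> (Bang W) \<otimes> k)) \<cdot> (\<one> (Bang W) \<otimes> \<sigma> (Bang W) W)
      = (\<one> (Bang W) \<otimes> \<sigma> (Bang W) B) \<cdot> (\<one> (Bang W) \<otimes> (k \<otimes> \<one> (Bang W)))"
    by (simp add: nat)
  then have swap: "(\<one> (Bang W) \<otimes> (\<one> (Bang W) \<otimes> k)) \<cdot> (\<one> (Bang W) \<otimes> \<sigma> (Bang W) W)
      = (\<one> (Bang W) \<otimes> \<sigma> (Bang W) B) \<cdot> ((\<one> (Bang W) \<otimes> k) \<otimes> \<one> (Bang W))"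
    by (simp add: tensor_assoc)
  have "(?j \<otimes> k) \<cdot> ((\<Delta> W \<otimes> \<one> W) \<cdot> (\<one> (Bang W) \<otimes> \<sigma> (Bang W) W) \<cdot> (d W \<otimes> \<one> (Bang W)))
        \<cdot> (bang p \<otimes> bang q)
      = ((?j \<otimes> k) \<cdot> (\<Delta> W \<otimes> \<one> W)) \<cdot> (\<one> (Bang W) \<otimes> \<sigma> (Bang W) W) \<cdot> ((d W \<cdot> bang p) \<otimes> bang q)"
    by simp
  also have "\<dots> = ((?j \<cdot> \<Delta> W) \<otimes> \<one> B)
        \<cdot> ((\<one> (Bang W) \<otimes> (\<one> (Bang W) \<otimes> k)) \<cdot> (\<one> (Bang W) \<otimes> \<sigma> (Bang W) W))
        \<cdot> ((d W \<cdot> bang p) \<otimes> bang q)"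
    unfolding slide by simp
  also have "\<dots> = ((?j \<cdot> \<Delta> W) \<otimes> \<one> B) \<cdot> (\<one> (Bang W) \<otimes> \<sigma> (Bang W) B)
        \<cdot> (((\<one> (Bang W) \<otimes> k) \<cdot> (d W \<cdot> bang p)) \<otimes> bang q)"
    unfolding swap by simp
  also have "\<dots> = \<zero> (Bang A \<odot> Bang B \<odot> B) (Bang A \<odot> Bang B)"
    unfolding p by simp
  finally have 1: "(?j \<otimes> k) \<cdot> ((\<Delta> W \<otimes> \<one> W) \<cdot> (\<one> (Bang W) \<otimes> \<sigma> (Bang W) W) \<cdot> (d W \<otimes> \<one> (Bang W)))
        \<cdot> (bang p \<otimes> bang q) = \<zero> (Bang A \<odot> Bang B \<odot> B) (Bang A \<odot> Bang B)" .
  \<comment> \<open>Second term: \<open>d W\<close> becomes \<open>d B\<close> by naturality along \<open>q\<close>, leaving the composite of \<open>merge\<close>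
    and \<open>split\<close>.\<close>
  have "(?j \<otimes> k) \<cdot> ((\<Delta> W \<otimes> \<one> W) \<cdot> (\<one> (Bang W) \<otimes> d W)) \<cdot> (bang p \<otimes> bang q)
      = ((?j \<cdot> \<Delta> W) \<otimes> k) \<cdot> (bang p \<otimes> ((bang q \<otimes> q) \<cdot> d B))"
    by (simp add: d_nat[OF wb_Hom(2)])
  also have "\<dots> = ((?j \<cdot> \<Delta> W) \<otimes> k) \<cdot> ((bang p \<otimes> bang q) \<otimes> q) \<cdot> (\<one> (Bang A) \<otimes> d B)"
    by (simp add: tensor_assoc)
  also have "\<dots> = ((?j \<cdot> split) \<otimes> (k \<cdot> q)) \<cdot> (\<one> (Bang A) \<otimes> d B)"
    by simp
  also have "\<dots> = \<one> (Bang A) \<otimes> d B"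
    unfolding merge_split by simp
  finally have 2: "(?j \<otimes> k) \<cdot> ((\<Delta> W \<otimes> \<one> W) \<cdot> (\<one> (Bang W) \<otimes> d W)) \<cdot> (bang p \<otimes> bang q)
      = \<one> (Bang A) \<otimes> d B" .
  have "(?j \<otimes> k) \<cdot> d W \<cdot> split = (?j \<otimes> k) \<cdot> (d W \<cdot> \<Delta> W) \<cdot> (bang p \<otimes> bang q)"
    by simp
  also have "\<dots> = \<one> (Bang A) \<otimes> d B"
    unfolding d_product[OF wb_typing(3)]
    using 1 2 by (simp add: comp_plus_left comp_plus_right)
  finally show ?thesis .
qed

text \<open>
  The previous lemma followed by \<open>merge\<close>: the idempotent \<open>split \<cdot> merge\<close> slides through \<open>d\<^sub>W\<close> by
  naturality and is absorbed both by \<open>merge\<close> and by \<open>k\<close>.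
\<close>

lemma d_merge: "(\<one> (Bang A) \<otimes> d B) \<cdot> merge A B i k = (merge A B i k \<otimes> k) \<cdot> d W"
proof -
  let ?j = "merge A B i k" and ?f = "p \<cdot> i \<oplus> q \<cdot> k"
  have f: "?f \<in> Hom X W W" by (simp add: Hom_iff)
  have j: "?j \<cdot> bang ?f = ?j"
  proof -
    have "?j \<cdot> bang ?f = (?j \<cdot> split) \<cdot> ?j"
      unfolding split_merge[symmetric] by simp
    then show ?thesis unfolding merge_split by simp
  qed
  have "k \<cdot> ?f = (k \<cdot> p) \<cdot> i \<oplus> (k \<cdot> q) \<cdot> k"
    by (simp add: comp_plus_right del: wb_laws)
  then have k: "k \<cdot> ?f = k" by simp
  have "(\<one> (Bang A) \<otimes> d B) \<cdot> ?j = (?j \<otimes> k) \<cdot> (d W \<cdot> (split \<cdot> ?j))"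
    unfolding d_split[symmetric] by simp
  also have "\<dots> = (?j \<otimes> k) \<cdot> ((bang ?f \<otimes> ?f) \<cdot> d W)"
    unfolding split_merge d_nat[OF f] ..
  also have "\<dots> = ((?j \<cdot> bang ?f) \<otimes> (k \<cdot> ?f)) \<cdot> d W" by simp
  finally show ?thesis unfolding j k .
qed

text \<open>
  The chain rule for \<open>!W\<close>, transported along the retraction \<open>merge\<close>, \<open>split\<close>.
\<close>

lemma d_tensor_coalg_of_weak_biproduct:
  "(\<one> (Bang A) \<otimes> d B) \<cdot> tensor_coalg A B
    = (tensor_comult A B \<otimes> \<one> B) \<cdot> (tensor_coalg A B \<otimes> (\<one> (Bang A) \<otimes> d B)) \<cdot> d (Bang A \<odot> Bang B)"
proof -
  let ?j = "merge A B i k"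
  have s: "split \<in> Hom X (Bang W) (Bang A \<odot> Bang B)" by (simp add: Hom_iff)
  have "(\<one> (Bang A) \<otimes> d B) \<cdot> tensor_coalg A B = ((\<one> (Bang A) \<otimes> d B) \<cdot> ?j) \<cdot> \<rho> W \<cdot> bang split"
    unfolding merge_rho_split[symmetric] by simp
  also have "\<dots> = (?j \<otimes> k) \<cdot> (d W \<cdot> \<rho> W) \<cdot> bang split"
    unfolding d_merge by simp
  also have "\<dots> = (?j \<otimes> k) \<cdot> (\<Delta> W \<otimes> \<one> W) \<cdot> (\<rho> W \<otimes> d W) \<cdot> (d (Bang W) \<cdot> bang split)"
    unfolding d_chain[OF wb_typing(3)] by simp
  also have "\<dots> = ((?j \<cdot> \<Delta> W) \<otimes> k) \<cdot> (\<rho> W \<otimes> d W) \<cdot> (bang split \<otimes> split) \<cdot> d (Bang A \<odot> Bang B)"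
    unfolding d_nat[OF s, symmetric] by simp
  also have "\<dots> = (tensor_comult A B \<otimes> \<one> B) \<cdot> ((?j \<otimes> ?j) \<otimes> k) \<cdot> (\<rho> W \<otimes> d W)
      \<cdot> (bang split \<otimes> split) \<cdot> d (Bang A \<odot> Bang B)"
    unfolding merge_comult by simp
  also have "\<dots> = (tensor_comult A B \<otimes> \<one> B)
      \<cdot> ((?j \<cdot> \<rho> W \<cdot> bang split) \<otimes> ((?j \<otimes> k) \<cdot> d W \<cdot> split)) \<cdot> d (Bang A \<odot> Bang B)"
    by (simp add: tensor_assoc)
  finally show ?thesis unfolding merge_rho_split d_split .
qed

end

lemma d_tensor_coalg:
  assumes "A \<in> Obj X" "B \<in> Obj X"
  shows "(\<one> (Bang A) \<otimes> d B) \<cdot> tensor_coalg A B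
    = (tensor_comult A B \<otimes> \<one> B) \<cdot> (tensor_coalg A B \<otimes> (\<one> (Bang A) \<otimes> d B)) \<cdot> d (Bang A \<odot> Bang B)"
  using d_tensor_coalg_of_weak_biproduct[OF weak_biproduct_Bang_tensor[OF assms]] .

end
section \<open>The action of the points of \<open>!I\<close>\<close>

context symmetric_monoidal_category
begin

text \<open>
  In this lemma and the next, \<open>f\<close> and \<open>f \<otimes> 1\<^sub>I\<close> are the same arrow, so both sides of each
  equation are the same string diagram, with \<open>b\<close> drawn at different heights.
\<close>

lemma comp_tensor_point:
  "f \<in> Arr X \<Longrightarrow> b \<in> Arr X \<Longrightarrow> Dom X b = I \<Longrightarrow> Cod X f = A \<Longrightarrow> f \<cdot> (\<one> A \<otimes> b) = f \<otimes> b"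
  using interchange[of f "\<one> A" "\<one> I" b] by auto

lemma tensor_copoint_comp:
  "f \<in> Arr X \<Longrightarrow> b \<in> Arr X \<Longrightarrow> Cod X b = I \<Longrightarrow> Dom X f = A \<Longrightarrow> (\<one> A \<otimes> b) \<cdot> f = f \<otimes> b"
  using interchange[of "\<one> A" f b "\<one> I"] by auto

end

context differential_linear_category
begin

text \<open>
  The codomain is \<open>!A\<close> because \<open>A \<otimes> I = A\<close> strictly.  On the symmetric algebra model, \<open>m\<close> pairs degree
  \<open>n\<close> with degree \<open>n\<close>, so a power series \<open>a\<close> acts on degree \<open>n\<close> by the scalar \<open>n!\<close> times the
  \<open>n\<close>-th coefficient of \<open>a\<close>.
\<close>

definition act where "act A a = (\<one> (Bang A) \<otimes> a) \<cdot> m A I"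

abbreviation coder where "coder A \<equiv> coderiving X Bang \<epsilon> \<Delta> A"

lemma act_typing [simp]:
  assumes "A \<in> Obj X" "a \<in> Arr X" "Dom X a = I" "Cod X a = Bang I"
  shows "act A a \<in> Arr X" "Dom X (act A a) = Bang A" "Cod X (act A a) = Bang A"
  using assms by (simp_all add: act_def)

lemma coder_typing [simp]:
  assumes "A \<in> Obj X"
  shows "coder A \<in> Arr X" "Dom X (coder A) = Bang A" "Cod X (coder A) = Bang A \<odot> A"
  using assms by (simp_all add: coderiving_def)

lemma act_mI: "A \<in> Obj X \<Longrightarrow> act A m\<^sub>I = \<one> (Bang A)"
  by (simp add: act_def m_unit_right)

lemma comp_act_unit:
  assumes [simp]: "a \<in> Arr X" "Dom X a = I" "Cod X a = Bang I" "b \<in> Arr X" "Dom X b = I" "Cod X b = Bang I"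
  shows "a \<cdot> act I b = (a \<otimes> b) \<cdot> m I I"
  unfolding act_def using comp_eq_tail[OF comp_tensor_point[of a b "Bang I"]] by simp

lemma act_comp:
  assumes [simp]: "A \<in> Obj X"
    "a \<in> Arr X" "Dom X a = I" "Cod X a = Bang I" "b \<in> Arr X" "Dom X b = I" "Cod X b = Bang I"
  shows "act A a \<cdot> act A b = act A (a \<cdot> act I b)"
proof -
  have m: "(m A I \<otimes> \<one> (Bang I)) \<cdot> m A I = (\<one> (Bang A) \<otimes> m I I) \<cdot> m A I"
    using m_assoc[of A I I] by simp
  have "act A a \<cdot> act A b = (act A a \<otimes> b) \<cdot> m A I"
    using comp_eq_tail[OF comp_tensor_point[of "act A a" b "Bang A"]] by (simp add: act_def[of A b])
  also have "act A a \<otimes> b = ((\<one> (Bang A) \<otimes> a) \<otimes> b) \<cdot> (m A I \<otimes> \<one> (Bang I))"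
    by (simp add: act_def)
  also have "\<dots> \<cdot> m A I = ((\<one> (Bang A) \<otimes> a) \<otimes> b) \<cdot> ((\<one> (Bang A) \<otimes> m I I) \<cdot> m A I)"
    unfolding m[symmetric] by simp
  also have "\<dots> = (\<one> (Bang A) \<otimes> ((a \<otimes> b) \<cdot> m I I)) \<cdot> m A I"
    by (simp add: tensor_assoc)
  finally show ?thesis
    unfolding act_def[of A "a \<cdot> act I b"] by (simp add: comp_act_unit)
qed

text \<open>
  Commutativity comes from the symmetry of \<open>m\<close>, since the symmetries \<open>\<sigma> I I\<close> are identities.
\<close>

lemma comp_act_commute:
  assumes [simp]: "a \<in> Arr X" "Dom X a = I" "Cod X a = Bang I" "b \<in> Arr X" "Dom X b = I" "Cod X b = Bang I"
  shows "a \<cdot> act I b = b \<cdot> act I a"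
proof -
  have 1: "\<sigma> (Bang I) (Bang I) \<cdot> m I I = m I I"
    using m_sym[of I I] by (simp add: sym_unit)
  have 2: "(a \<otimes> b) \<cdot> \<sigma> (Bang I) (Bang I) = b \<otimes> a"
    using sym_natural[of a I "Bang I" b I "Bang I"] by (simp add: Hom_iff sym_unit)
  have "(a \<otimes> b) \<cdot> m I I = (a \<otimes> b) \<cdot> (\<sigma> (Bang I) (Bang I) \<cdot> m I I)" by (simp only: 1)
  also have "\<dots> = (b \<otimes> a) \<cdot> m I I" by (rule comp_eq_tail[OF 2]) simp_all
  finally show ?thesis by (simp add: comp_act_unit)
qed

lemma act_plus:
  assumes "A \<in> Obj X"
    "a \<in> Arr X" "Dom X a = I" "Cod X a = Bang I" "b \<in> Arr X" "Dom X b = I" "Cod X b = Bang I"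
  shows "act A (a \<oplus> b) = act A a \<oplus> act A b"
  using assms by (simp add: act_def tensor_plus_right comp_plus_left)

lemma act_natural:
  assumes f: "f \<in> Hom X A B" and [simp]: "a \<in> Arr X" "Dom X a = I" "Cod X a = Bang I"
  shows "bang f \<cdot> act B a = act A a \<cdot> bang f"
proof -
  note [simp] = Hom_Obj[OF f] and ty [simp] = f[unfolded Hom_iff]
  have nat: "(bang f \<otimes> bang (\<one> I)) \<cdot> m B I = m A I \<cdot> bang (f \<otimes> \<one> I)"
    by (rule m_natural) (simp_all add: Hom_iff)
  have "bang f \<cdot> act B a = (bang f \<otimes> a) \<cdot> m B I"
    unfolding act_def using comp_eq_tail[OF comp_tensor_point[of "bang f" a "Bang B"]] by simp
  also have "\<dots> = (\<one> (Bang A) \<otimes> a) \<cdot> ((bang f \<otimes> bang (\<one> I)) \<cdot> m B I)"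
    by simp
  also have "\<dots> = act A a \<cdot> bang f"
    unfolding nat by (simp add: act_def)
  finally show ?thesis .
qed

lemma act_zero:
  assumes [simp]: "A \<in> Obj X"
  shows "act A (m\<^sub>I \<cdot> bang (\<zero> I I)) = bang (\<zero> A A)"
proof -
  have nat: "(bang (\<one> A) \<otimes> bang (\<zero> I I)) \<cdot> m A I = m A I \<cdot> bang (\<one> A \<otimes> \<zero> I I)"
    by (rule m_natural) (simp_all add: Hom_iff)
  have "act A (m\<^sub>I \<cdot> bang (\<zero> I I)) = (\<one> (Bang A) \<otimes> m\<^sub>I) \<cdot> ((bang (\<one> A) \<otimes> bang (\<zero> I I)) \<cdot> m A I)"
    by (simp add: act_def)
  also have "\<dots> = act A m\<^sub>I \<cdot> bang (\<zero> A A)"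
    unfolding nat by (simp add: act_def)
  finally show ?thesis by (simp add: act_mI)
qed

text \<open>
  The chain rule \<open>d_tensor_coalg\<close> followed by \<open>!(\<epsilon> A \<otimes> \<epsilon> I)\<close>, which turns the coalgebra structure
  into \<open>m\<close>.
\<close>

lemma d_m_unit:
  assumes [simp]: "A \<in> Obj X"
  shows "(\<one> (Bang A) \<otimes> d I) \<cdot> m A I = tensor_comult A I \<cdot> (m A I \<otimes> (\<epsilon> A \<otimes> e I)) \<cdot> d A"
proof -
  let ?f = "\<epsilon> A \<otimes> \<epsilon> I"
  have f: "?f \<in> Hom X (Bang A \<odot> Bang I) A" by (simp add: Hom_iff)
  have "(\<one> (Bang A) \<otimes> d I) \<cdot> m A I = ((\<one> (Bang A) \<otimes> d I) \<cdot> tensor_coalg A I) \<cdot> bang ?f"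
    by (simp add: tensor_coalg_eps_eps)
  also have "\<dots> = tensor_comult A I \<cdot> (tensor_coalg A I \<otimes> (\<one> (Bang A) \<otimes> d I)) \<cdot> ((bang ?f \<otimes> ?f) \<cdot> d A)"
    unfolding d_nat[OF f] by (simp add: d_tensor_coalg)
  also have "\<dots> = tensor_comult A I \<cdot> ((tensor_coalg A I \<cdot> bang ?f) \<otimes> (\<epsilon> A \<otimes> (d I \<cdot> \<epsilon> I))) \<cdot> d A"
    by simp
  finally show ?thesis by (simp add: tensor_coalg_eps_eps d_linear)
qed

text \<open>
  A string diagram computation: the counit \<open>e I\<close> cancels one of the two copies of \<open>a\<close>
  made by \<open>tensor_comult\<close>, and the symmetry moves the remaining copy, whose domain is \<open>I\<close>,
  past \<open>!A\<close>.
\<close>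

lemma act_comult:
  assumes [simp]: "A \<in> Obj X" "a \<in> Arr X" "Dom X a = I" "Cod X a = Bang I"
  shows "(\<one> (Bang A) \<otimes> a) \<cdot> tensor_comult A I \<cdot> (m A I \<otimes> (\<epsilon> A \<otimes> e I)) = coder A \<cdot> (act A a \<otimes> \<one> A)"
proof -
  let ?A = "Bang A" and ?R = "Bang I"
  let ?x = "(\<one> ?A \<otimes> \<sigma> ?A ?R) \<cdot> (m A I \<otimes> \<epsilon> A)"
  have "m A I \<otimes> (\<epsilon> A \<otimes> e I) = (m A I \<otimes> \<epsilon> A) \<otimes> e I"
    by (simp add: tensor_assoc)
  then have "(\<one> ?A \<otimes> a) \<cdot> tensor_comult A I \<cdot> (m A I \<otimes> (\<epsilon> A \<otimes> e I))
      = (\<Delta> A \<otimes> (a \<cdot> \<Delta> I)) \<cdot> (?x \<otimes> e I)"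
    by (simp add: tensor_comult_def)
  also have "?x \<otimes> e I = (\<one> (?A \<odot> ?A \<odot> ?R) \<otimes> e I) \<cdot> ?x"
    by (rule tensor_copoint_comp[symmetric]) simp_all
  also have "\<one> (?A \<odot> ?A \<odot> ?R) \<otimes> e I = \<one> (?A \<odot> ?A) \<otimes> (\<one> ?R \<otimes> e I)"
    by (simp flip: tensor_assoc)
  also have "(\<Delta> A \<otimes> (a \<cdot> \<Delta> I)) \<cdot> (\<dots> \<cdot> ?x) = (\<Delta> A \<otimes> (a \<cdot> (\<Delta> I \<cdot> (\<one> ?R \<otimes> e I)))) \<cdot> ?x"
    by simp
  also have "\<dots> = (\<Delta> A \<otimes> a) \<cdot> ?x"
    by (simp add: Delta_counit_right del: interchange interchange_tail)
  also have "\<Delta> A \<otimes> a = \<Delta> A \<cdot> (\<one> (?A \<odot> ?A) \<otimes> a)"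
    by (rule comp_tensor_point[symmetric]) simp_all
  also have "\<one> (?A \<odot> ?A) \<otimes> a = \<one> ?A \<otimes> (\<one> ?A \<otimes> a)"
    by (simp flip: tensor_assoc)
  also have "\<Delta> A \<cdot> \<dots> \<cdot> ?x = \<Delta> A \<cdot> ((\<one> ?A \<otimes> ((\<one> ?A \<otimes> a) \<cdot> \<sigma> ?A ?R)) \<cdot> (m A I \<otimes> \<epsilon> A))"
    by simp
  also have "(\<one> ?A \<otimes> a) \<cdot> \<sigma> ?A ?R = a \<otimes> \<one> ?A"
    using sym_natural[of "\<one> ?A" ?A ?A a I ?R] by (simp add: Hom_iff sym_unit)
  also have "\<one> ?A \<otimes> (a \<otimes> \<one> ?A) = (\<one> ?A \<otimes> a) \<otimes> \<one> ?A"
    by (simp add: tensor_assoc)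
  finally show ?thesis
    by (simp add: act_def coderiving_def)
qed

lemma act_d:
  assumes [simp]: "A \<in> Obj X" "a \<in> Arr X" "Dom X a = I" "Cod X a = Bang I"
  shows "act A (a \<cdot> d I) = coder A \<cdot> (act A a \<otimes> \<one> A) \<cdot> d A"
proof -
  have "act A (a \<cdot> d I) = (\<one> (Bang A) \<otimes> a) \<cdot> ((\<one> (Bang A) \<otimes> d I) \<cdot> m A I)"
    by (simp add: act_def)
  also have "\<dots> = ((\<one> (Bang A) \<otimes> a) \<cdot> tensor_comult A I \<cdot> (m A I \<otimes> (\<epsilon> A \<otimes> e I))) \<cdot> d A"
    unfolding d_m_unit[OF assms(1)] by simp
  finally show ?thesis unfolding act_comult[OF assms] .
qed

section \<open>Antiderivatives\<close>

abbreviation K where "K A \<equiv> K_map X Bang bang \<epsilon> \<Delta> d A"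

lemma K_typing [simp]:
  assumes "A \<in> Obj X"
  shows "K A \<in> Arr X" "Dom X (K A) = Bang A" "Cod X (K A) = Bang A"
  using assms by (simp_all add: K_map_def)

lemma K_eq_act:
  assumes [simp]: "A \<in> Obj X"
  shows "K A = act A (m\<^sub>I \<cdot> d I \<oplus> m\<^sub>I \<cdot> bang (\<zero> I I))"
  by (simp add: act_plus act_d act_zero act_mI K_map_def)

text \<open>
  Each \<open>K A\<close> is the action of one point, the same for all \<open>A\<close>, and actions of points are natural.
\<close>

lemma K_natural: "natural_transformation X Bang bang Bang bang K"
  unfolding natural_transformation_def
proof (intro conjI ballI allI)
  fix A B f assume f: "f \<in> Hom X A B"
  show "bang f \<cdot> K B = K A \<cdot> bang f"
    unfolding K_eq_act[OF Hom_Obj(1)[OF f]] K_eq_act[OF Hom_Obj(2)[OF f]]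
    by (rule act_natural[OF f]) simp_all
qed (simp add: Hom_iff)

lemma bang_zero_coder:
  assumes [simp]: "A \<in> Obj X"
  shows "bang (\<zero> A A) \<cdot> coder A = \<zero> (Bang A) (Bang A \<odot> A)"
proof -
  have z: "\<zero> A A \<in> Hom X A A" by (simp add: Hom_iff)
  have "bang (\<zero> A A) \<cdot> coder A = (bang (\<zero> A A) \<cdot> \<Delta> A) \<cdot> (\<one> (Bang A) \<otimes> \<epsilon> A)"
    by (simp add: coderiving_def)
  also have "\<dots> = \<Delta> A \<cdot> (bang (\<zero> A A) \<otimes> (bang (\<zero> A A) \<cdot> \<epsilon> A))"
    unfolding Delta_nat[OF z] by simp
  finally show ?thesis unfolding eps_nat[OF z] by simp
qed

lemma d_bang_zero:
  assumes [simp]: "A \<in> Obj X"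
  shows "d A \<cdot> bang (\<zero> A A) = \<zero> (Bang A \<odot> A) (Bang A)"
  using d_nat[of "\<zero> A A" A A] by (simp add: Hom_iff)

lemma bang_zero_idem: "A \<in> Obj X \<Longrightarrow> bang (\<zero> A A) \<cdot> bang (\<zero> A A) = bang (\<zero> A A)"
  by (simp flip: bang_simps(2))

text \<open>
  The product rule at \<open>I\<close>, where the symmetry in its first term is trivial.  In the power series model
  this is the Leibniz rule \<open>(x f)' = x f' + f\<close>.
\<close>

lemma d_coder_unit: "d I \<cdot> coder I = coder I \<cdot> d I \<oplus> \<one> (Bang I)"
proof -
  have 1: "(\<one> (Bang I) \<otimes> \<epsilon> I) \<cdot> d I = d I \<otimes> \<epsilon> I"
    by (rule tensor_copoint_comp) simp_all
  have "d I \<cdot> coder I = (d I \<cdot> \<Delta> I) \<cdot> (\<one> (Bang I) \<otimes> \<epsilon> I)"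
    by (simp add: coderiving_def)
  also have "\<dots> = \<Delta> I \<cdot> (d I \<otimes> \<epsilon> I) \<oplus> \<Delta> I \<cdot> (\<one> (Bang I) \<otimes> (d I \<cdot> \<epsilon> I))"
    unfolding d_product[OF unit_Obj] by (simp add: comp_plus_left sym_unit)
  finally show ?thesis
    by (simp add: d_linear Delta_counit_right coderiving_def 1)
qed

lemma d_K_unit: "d I \<cdot> K I = (d I \<cdot> coder I) \<cdot> d I"
  by (simp add: K_map_def comp_plus_right d_bang_zero)

lemma bang_zero_K:
  assumes [simp]: "A \<in> Obj X"
  shows "bang (\<zero> A A) \<cdot> K A = bang (\<zero> A A)"
proof -
  have "bang (\<zero> A A) \<cdot> K A = (bang (\<zero> A A) \<cdot> coder A) \<cdot> d A \<oplus> bang (\<zero> A A) \<cdot> bang (\<zero> A A)"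
    by (simp add: K_map_def comp_plus_right)
  then show ?thesis by (simp add: bang_zero_coder bang_zero_idem)
qed

lemma mI_coder: "m\<^sub>I \<cdot> coder I = m\<^sub>I"
proof -
  have "m\<^sub>I \<cdot> coder I = (m\<^sub>I \<cdot> \<Delta> I) \<cdot> (\<one> (Bang I) \<otimes> \<epsilon> I)"
    by (simp add: coderiving_def)
  then show ?thesis unfolding mI_Delta by (simp add: mI_eps)
qed

text \<open>
  The equation for \<open>s\<close> followed by the coderiving map says that \<open>s\<close> undoes \<open>J = d\<^sub>I d\<degree>\<^sub>I\<close> up to
  \<open>d\<degree>\<^sub>I\<close>, because \<open>!(0)\<close> kills \<open>d\<degree>\<^sub>I\<close>; as \<open>m\<^sub>I\<close> is fixed by \<open>d\<degree>\<^sub>I\<close>, the action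
  of the point \<open>t = m\<^sub>I s\<close> inverts \<open>J\<close>.  In the composite of \<open>l\<close> with \<open>K I\<close> this cancels one of the two factors \<open>t\<close>, and the
  equation for \<open>s\<close> then removes the other.
\<close>

lemma point_inverting_K_unit:
  assumes s: "s \<in> Hom X (Bang I) (Bang I)" and eq: "s \<cdot> d I \<oplus> bang (\<zero> I I) = \<one> (Bang I)"
  obtains l where "l \<in> Hom X I (Bang I)" "l \<cdot> K I = m\<^sub>I"
proof
  note [simp] = s[unfolded Hom_iff]
  define t where "t = m\<^sub>I \<cdot> s"
  define J where "J = coder I \<cdot> d I \<oplus> \<one> (Bang I)"
  define T where "T = act I t"
  define z where "z = bang (\<zero> I I)"
  have [simp]: "t \<in> Arr X" "Dom X t = I" "Cod X t = Bang I"
    by (simp_all add: t_def)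
  have [simp]: "J \<in> Arr X" "Dom X J = Bang I" "Cod X J = Bang I"
    "T \<in> Arr X" "Dom X T = Bang I" "Cod X T = Bang I"
    "z \<in> Arr X" "Dom X z = Bang I" "Cod X z = Bang I"
    by (simp_all add: J_def T_def z_def)
  have "coder I = (s \<cdot> d I \<oplus> z) \<cdot> coder I"
    using eq by (simp add: z_def)
  also have "\<dots> = s \<cdot> J"
    by (simp add: comp_plus_left bang_zero_coder z_def J_def d_coder_unit)
  finally have tJ: "t \<cdot> J = m\<^sub>I"
    using mI_coder by (simp add: t_def)
  have J: "J = act I (m\<^sub>I \<cdot> d I \<oplus> m\<^sub>I)"
    by (simp add: J_def act_plus act_d act_mI)
  have "T \<cdot> J = act I (t \<cdot> J)"
    unfolding J T_def by (rule act_comp) simp_all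
  then have TJ: "T \<cdot> J = \<one> (Bang I)"
    unfolding tJ by (simp add: act_mI)
  have "(t \<cdot> T \<cdot> d I \<oplus> m\<^sub>I \<cdot> z) \<cdot> K I = t \<cdot> T \<cdot> (d I \<cdot> K I) \<oplus> m\<^sub>I \<cdot> (z \<cdot> K I)"
    by (simp add: comp_plus_left)
  also have "\<dots> = t \<cdot> T \<cdot> (J \<cdot> d I) \<oplus> m\<^sub>I \<cdot> z"
    by (simp only: d_K_unit bang_zero_K d_coder_unit z_def J_def unit_Obj)
  also have "\<dots> = t \<cdot> (T \<cdot> J) \<cdot> d I \<oplus> m\<^sub>I \<cdot> z"
    by simp
  also have "\<dots> = m\<^sub>I \<cdot> (s \<cdot> d I \<oplus> z)"
    unfolding TJ by (simp add: comp_plus_right t_def)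
  finally show "(t \<cdot> T \<cdot> d I \<oplus> m\<^sub>I \<cdot> z) \<cdot> K I = m\<^sub>I"
    using eq by (simp add: z_def)
  show "t \<cdot> T \<cdot> d I \<oplus> m\<^sub>I \<cdot> z \<in> Hom X I (Bang I)"
    by (simp add: Hom_iff)
qed

text \<open>
  Inverting the point that acts as \<open>K\<close> inverts all components at once; commutativity of the monoid of
  points turns the one-sided inverse into a two-sided one.
\<close>

lemma antiderivatives_if_unit_solution:
  assumes "s \<in> Hom X (Bang I) (Bang I)" "s \<cdot> d I \<oplus> bang (\<zero> I I) = \<one> (Bang I)"
  shows "has_antiderivatives X Bang bang \<epsilon> \<Delta> d"
proof -
  let ?k = "m\<^sub>I \<cdot> d I \<oplus> m\<^sub>I \<cdot> bang (\<zero> I I)"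
  obtain l where l: "l \<in> Hom X I (Bang I)" "l \<cdot> K I = m\<^sub>I"
    using point_inverting_K_unit[OF assms] .
  note [simp] = l(1)[unfolded Hom_iff]
  have lk: "l \<cdot> act I ?k = m\<^sub>I"
    using l(2) K_eq_act[of I] by simp
  have kl: "?k \<cdot> act I l = m\<^sub>I"
    using comp_act_commute[of ?k l] lk by simp
  have "is_iso X (K A)" if [simp]: "A \<in> Obj X" for A
  proof -
    have "act A l \<cdot> K A = act A (l \<cdot> act I ?k)" "K A \<cdot> act A l = act A (?k \<cdot> act I l)"
      unfolding K_eq_act[OF that] by (rule act_comp; simp)+
    then have "act A l \<cdot> K A = \<one> (Bang A)" "K A \<cdot> act A l = \<one> (Bang A)"
      unfolding lk kl by (simp_all add: act_mI)
    then show ?thesis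
      unfolding is_iso_def by (auto simp: Hom_iff intro!: bexI[of _ "act A l"])
  qed
  then show ?thesis
    by (simp add: has_antiderivatives_def natural_isomorphism_def K_natural)
qed

lemma unit_solution_if_antiderivatives:
  assumes "has_antiderivatives X Bang bang \<epsilon> \<Delta> d"
  shows "\<exists>s \<in> Hom X (Bang I) (Bang I). s \<cdot> d I \<oplus> bang (\<zero> I I) = \<one> (Bang I)"
proof -
  let ?z = "bang (\<zero> I I)"
  have "is_iso X (K I)"
    using assms by (simp add: has_antiderivatives_def natural_isomorphism_def)
  then obtain g where g: "g \<in> Hom X (Bang I) (Bang I)" and gK: "g \<cdot> K I = \<one> (Bang I)"
    by (auto simp: is_iso_def)
  note [simp] = g[unfolded Hom_iff]
  have Kz: "K I \<cdot> ?z = ?z"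
    by (simp add: K_map_def comp_plus_left d_bang_zero bang_zero_idem del: bang_simps)
  have "g \<cdot> ?z = (g \<cdot> K I) \<cdot> ?z" using Kz by simp
  then have gz: "g \<cdot> ?z = ?z" unfolding gK by simp
  have "(g \<cdot> coder I) \<cdot> d I \<oplus> ?z = g \<cdot> (coder I \<cdot> d I \<oplus> ?z)"
    by (simp add: comp_plus_right gz)
  also have "\<dots> = \<one> (Bang I)" using gK by (simp add: K_map_def)
  finally show ?thesis
    by (intro bexI[of _ "g \<cdot> coder I"]) (simp_all add: Hom_iff)
qed

end

theorem theorem4p8:
  fixes X :: "('o, 'a, 'z) asmc_scheme" (structure)
    and Bang :: "'o \<Rightarrow> 'o" and bang :: "'a \<Rightarrow> 'a"
    and \<rho> \<epsilon> \<Delta> e d :: "'o \<Rightarrow> 'a"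
    and m :: "'o \<Rightarrow> 'o \<Rightarrow> 'a" and m\<^sub>I :: 'a
  assumes "differential_linear_category X Bang bang \<rho> \<epsilon> \<Delta> e m m\<^sub>I d"
  shows "has_antiderivatives X Bang bang \<epsilon> \<Delta> d \<longleftrightarrow>
    (\<exists>s \<in> Hom X (Bang I) (Bang I). s \<cdot> d I \<oplus> bang (\<zero> I I) = \<one> (Bang I))"
proof -
  interpret differential_linear_category X Bang bang \<rho> \<epsilon> \<Delta> e m m\<^sub>I d
    by (fact assms)
  show ?thesis
    using antiderivatives_if_unit_solution unit_solution_if_antiderivatives by blast
qed

end
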